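(* Let $C_n$ be a cycle graph with vertices $1,\ldots,n$ (vertex $i$ being identified with the variable $x_i$) and edge set $E(C_n)=\{\{x_i,x_{i+1}\} : i=1,\ldots,n\}$, where $x_{n+1}$ represents $x_1$, and let $DI(C_n)$ be its dominating ideal. Then the following statements hold: (i) $DI(C_n)$ is normal. (ii) $DI(C_n)$ has the strong persistence property. (iii) $DI(C_n)$ has the persistence property.
   Context: For a finite simple graph $G$ with vertex set $\{1,\ldots,n\}$, let $N_G[v]=\{v\}\cup\{u:\{u,v\}\in E(G)\}$. A set $S\subseteq V(G)$ is dominating if $S\cap N_G[v]\neq\emptyset$ for all $v\in V(G)$, and minimal dominating if in addition no proper subset is dominating. The dominating ideal is $DI(G)=\bigl(\prod_{i\in S}x_i: S\text{ a minimal dominating set of }G\bigr)\subset R=K[x_1,\ldots,x_n]$, $K$ a field. An ideal is normal if all its powers are integrally closed. An ideal $I$ of $R$ has the persistence property if $\mathrm{Ass}_R(R/I^k)\subseteq\mathrm{Ass}_R(R/I^{k+1})$ for all $k\ge1$, and the strong persistence property if $(I^{k+1}:_RI)=I^k$ for all $k\ge1$. *)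

theory Defs
  imports
    "HOL-Library.Poly_Mapping"
    "HOL-Algebra.Module"
    "HOL-Algebra.QuotRing"
    "HOL-Algebra.Ideal_Product"
begin

section \<open>Finite simple graphs and dominating sets\<close>

record 'v sgraph =
  verts :: "'v set"
  edges :: "'v set set"

definition simple_graph :: "'v sgraph \<Rightarrow> bool" where
  "simple_graph G \<longleftrightarrow> finite (verts G) \<and> (\<forall>e\<in>edges G. e \<subseteq> verts G \<and> card e = 2)"

definition closed_nbhd :: "'v sgraph \<Rightarrow> 'v \<Rightarrow> 'v set" where
  "closed_nbhd G v = {v} \<union> {u. {u, v} \<in> edges G}"

definition dominating_set :: "'v sgraph \<Rightarrow> 'v set \<Rightarrow> bool" where
  "dominating_set G S \<longleftrightarrow> S \<subseteq> verts G \<and> (\<forall>v\<in>verts G. S \<inter> closed_nbhd G v \<noteq> {})"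

definition minimal_dominating_set :: "'v sgraph \<Rightarrow> 'v set \<Rightarrow> bool" where
  "minimal_dominating_set G S \<longleftrightarrow>
     dominating_set G S \<and> (\<forall>T. T \<subset> S \<longrightarrow> \<not> dominating_set G T)"

definition cycle_graph :: "nat \<Rightarrow> nat sgraph" where
  "cycle_graph n =
     \<lparr>verts = {1..n}, edges = (\<lambda>i. {i, if i = n then 1 else i + 1}) ` {1..n}\<rparr>"

lemma simple_graph_cycle_graph: "n \<ge> 3 \<Longrightarrow> simple_graph (cycle_graph n)"
  by (auto simp: simple_graph_def cycle_graph_def)


section \<open>Polynomial rings\<close>

text \<open>A polynomial is a finitely supported map from exponent vectors to coefficients.
  The type admits all elements of \<^typ>\<open>'v\<close> as variables; the carrier of
  \<open>mpoly_ring V\<close> restricts to the variables in \<open>V\<close>.\<close>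

type_synonym ('v, 'k) mpoly = "('v \<Rightarrow>\<^sub>0 nat) \<Rightarrow>\<^sub>0 'k"

definition mpoly_ring :: "'v set \<Rightarrow> ('v, 'k::field) mpoly ring" where
  "mpoly_ring V =
     \<lparr>carrier = {p. \<forall>m\<in>Poly_Mapping.keys p. Poly_Mapping.keys m \<subseteq> V},
      mult = (*), one = 1, zero = 0, add = (+)\<rparr>"

definition mvar :: "'v \<Rightarrow> ('v, 'k::field) mpoly" where
  "mvar v = Poly_Mapping.single (Poly_Mapping.single v 1) 1"

lemma cring_mpoly_ring: "cring (mpoly_ring V :: ('v, 'k::field) mpoly ring)"
proof (rule cringI)
  show "abelian_group (mpoly_ring V :: ('v, 'k) mpoly ring)"
  proof (rule abelian_groupI)
    fix p q :: "('v, 'k) mpoly"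
    assume "p \<in> carrier (mpoly_ring V)" "q \<in> carrier (mpoly_ring V)"
    then show "p \<oplus>\<^bsub>mpoly_ring V\<^esub> q \<in> carrier (mpoly_ring V)"
      using Poly_Mapping.keys_add[of p q] by (auto simp: mpoly_ring_def)
  next
    fix p :: "('v, 'k) mpoly"
    assume "p \<in> carrier (mpoly_ring V)"
    then show "\<exists>q\<in>carrier (mpoly_ring V). q \<oplus>\<^bsub>mpoly_ring V\<^esub> p = \<zero>\<^bsub>mpoly_ring V\<^esub>"
      by (intro bexI[of _ "- p"]) (auto simp: mpoly_ring_def)
  qed (auto simp: mpoly_ring_def algebra_simps)
  show "Group.comm_monoid (mpoly_ring V :: ('v, 'k) mpoly ring)"
  proof (rule comm_monoidI)
    fix p q :: "('v, 'k) mpoly"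
    assume pq: "p \<in> carrier (mpoly_ring V)" "q \<in> carrier (mpoly_ring V)"
    have "Poly_Mapping.keys m \<subseteq> V" if "m \<in> Poly_Mapping.keys (p * q)" for m
    proof -
      from that Poly_Mapping.keys_mult[of p q] obtain a b
        where "a \<in> Poly_Mapping.keys p" "b \<in> Poly_Mapping.keys q" "m = a + b" by blast
      with pq show ?thesis
        using Poly_Mapping.keys_add[of a b] by (fastforce simp: mpoly_ring_def)
    qed
    then show "p \<otimes>\<^bsub>mpoly_ring V\<^esub> q \<in> carrier (mpoly_ring V)"
      by (simp add: mpoly_ring_def)
  qed (auto simp: mpoly_ring_def algebra_simps)
qed (auto simp: mpoly_ring_def algebra_simps)

lemma mvar_in_carrier: "v \<in> V \<Longrightarrow> mvar v \<in> carrier (mpoly_ring V)"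
  by (auto simp: mvar_def mpoly_ring_def)

definition dominating_ideal :: "'v sgraph \<Rightarrow> ('v, 'k::field) mpoly set" where
  "dominating_ideal G =
     Idl\<^bsub>mpoly_ring (verts G)\<^esub>
       {\<Prod>i\<in>S. mvar i | S. minimal_dominating_set G S}"


lemma ideal_dominating_ideal:
  assumes "simple_graph G"
  shows "ideal (dominating_ideal G :: ('v, 'k::field) mpoly set) (mpoly_ring (verts G))"
proof -
  interpret cring "mpoly_ring (verts G) :: ('v, 'k) mpoly ring" by (rule cring_mpoly_ring)
  have "(\<Prod>i\<in>S. mvar i :: ('v, 'k) mpoly) \<in> carrier (mpoly_ring (verts G))"
    if "finite S" "S \<subseteq> verts G" for S
    using that
  proof (induction S rule: finite_induct)
    case empty
    then show ?case using one_closed by (simp add: mpoly_ring_def)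
  next
    case (insert v S)
    then show ?case using m_closed[OF mvar_in_carrier[of v "verts G"]]
      by (simp add: mpoly_ring_def)
  qed
  moreover have "finite S \<and> S \<subseteq> verts G" if "minimal_dominating_set G S" for S
    using that assms finite_subset
    by (auto simp: minimal_dominating_set_def dominating_set_def simple_graph_def)
  ultimately show ?thesis
    unfolding dominating_ideal_def by (intro genideal_ideal) blast
qed


section \<open>Powers, colons and integral closures of ideals\<close>

abbreviation ideal_power :: "('a, 'b) ring_scheme \<Rightarrow> 'a set \<Rightarrow> nat \<Rightarrow> 'a set" where
  "ideal_power R I k \<equiv> I [^]\<^bsub>ideals_set R\<^esub> k"

definition ideal_colon :: "('a, 'b) ring_scheme \<Rightarrow> 'a set \<Rightarrow> 'a set \<Rightarrow> 'a set" where
  "ideal_colon R J I = {r \<in> carrier R. \<forall>s\<in>I. r \<otimes>\<^bsub>R\<^esub> s \<in> J}"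

definition integral_over_ideal :: "('a, 'b) ring_scheme \<Rightarrow> 'a set \<Rightarrow> 'a \<Rightarrow> bool" where
  "integral_over_ideal R I r \<longleftrightarrow>
     (\<exists>(m::nat) a. m \<ge> 1 \<and> (\<forall>i\<in>{1..m}. a i \<in> ideal_power R I i) \<and>
        r [^]\<^bsub>R\<^esub> m \<oplus>\<^bsub>R\<^esub> (\<Oplus>\<^bsub>R\<^esub> i\<in>{1..m}. a i \<otimes>\<^bsub>R\<^esub> r [^]\<^bsub>R\<^esub> (m - i)) = \<zero>\<^bsub>R\<^esub>)"

definition integral_closure_ideal :: "('a, 'b) ring_scheme \<Rightarrow> 'a set \<Rightarrow> 'a set" where
  "integral_closure_ideal R I = {r \<in> carrier R. integral_over_ideal R I r}"

definition integrally_closed_ideal :: "('a, 'b) ring_scheme \<Rightarrow> 'a set \<Rightarrow> bool" where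
  "integrally_closed_ideal R I \<longleftrightarrow> integral_closure_ideal R I = I"

definition normal_ideal :: "('a, 'b) ring_scheme \<Rightarrow> 'a set \<Rightarrow> bool" where
  "normal_ideal R I \<longleftrightarrow> (\<forall>k\<ge>1. integrally_closed_ideal R (ideal_power R I k))"


section \<open>Associated primes and persistence\<close>

text \<open>The quotient \<open>R / I\<close> as an \<open>R\<close>-module, with \<open>r \<odot> (I + x) = I + r x\<close>.\<close>

definition quot_module :: "('a, 'b) ring_scheme \<Rightarrow> 'a set \<Rightarrow> ('a, 'a set) module" where
  "quot_module R I =
     ring.extend (R Quot I)
       \<lparr>smult = (\<lambda>r X. (I +>\<^bsub>R\<^esub> r) \<otimes>\<^bsub>R Quot I\<^esub> X)\<rparr>"

lemma (in cring) quot_module_smult: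
  assumes "ideal I R" "r \<in> carrier R" "x \<in> carrier R"
  shows "r \<odot>\<^bsub>quot_module R I\<^esub> (I +> x) = I +> (r \<otimes> x)"
  using ideal.rcoset_mult_add[OF assms]
  by (simp add: quot_module_def ring.defs FactRing_def)

lemma (in cring) module_quot_module:
  assumes "ideal I R"
  shows "module R (quot_module R I)"
proof -
  interpret I: ideal I R by fact
  interpret Q: cring "R Quot I" by (rule I.quotient_is_cring[OF is_cring])
  interpret h: ring_hom_ring R "R Quot I" "\<lambda>r. I +> r" by (rule I.rcos_ring_hom_ring)
  note qm = quot_module_def ring.defs
  have sm: "r \<odot>\<^bsub>quot_module R I\<^esub> X = (I +> r) \<otimes>\<^bsub>R Quot I\<^esub> X" for r X
    by (simp add: qm)
  have car: "carrier (quot_module R I) = carrier (R Quot I)" by (simp add: qm)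
  have ad: "X \<oplus>\<^bsub>quot_module R I\<^esub> Y = X \<oplus>\<^bsub>R Quot I\<^esub> Y" for X Y by (simp add: qm)
  have ze: "\<zero>\<^bsub>quot_module R I\<^esub> = \<zero>\<^bsub>R Quot I\<^esub>" by (simp add: qm)
  show ?thesis
  proof (rule moduleI)
    show "abelian_group (quot_module R I)"
      by (rule abelian_groupI)
        (auto simp: car ad ze Q.a_ac intro: Q.l_neg bexI[of _ "\<ominus>\<^bsub>R Quot I\<^esub> _"])
  qed (simp_all add: is_cring sm car ad Q.l_distr Q.r_distr Q.m_assoc)
qed

definition annihilator :: "('a, 'b) ring_scheme \<Rightarrow> ('a, 'm, 'c) module_scheme \<Rightarrow> 'm \<Rightarrow> 'a set" where
  "annihilator R M x = {r \<in> carrier R. r \<odot>\<^bsub>M\<^esub> x = \<zero>\<^bsub>M\<^esub>}"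

definition Ass :: "('a, 'b) ring_scheme \<Rightarrow> ('a, 'm, 'c) module_scheme \<Rightarrow> 'a set set" where
  "Ass R M = {P. primeideal P R \<and> (\<exists>x\<in>carrier M. P = annihilator R M x)}"

definition persistence_property :: "('a, 'b) ring_scheme \<Rightarrow> 'a set \<Rightarrow> bool" where
  "persistence_property R I \<longleftrightarrow>
     (\<forall>k\<ge>1. Ass R (quot_module R (ideal_power R I k))
            \<subseteq> Ass R (quot_module R (ideal_power R I (k + 1))))"

definition strong_persistence_property :: "('a, 'b) ring_scheme \<Rightarrow> 'a set \<Rightarrow> bool" where
  "strong_persistence_property R I \<longleftrightarrow>
     (\<forall>k\<ge>1. ideal_colon R (ideal_power R I (k + 1)) I = ideal_power R I k)"

end

theory Submission
  imports Defs "HOL-Library.Multiset" "HOL.Topological_Spaces"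
begin

text \<open>
  The argument separates commutative algebra from combinatorics. Let \<open>I\<close> be generated by the
  monomials with exponents in a finite set \<open>F\<close>, and let \<open>E\<^sub>k\<close> (\<open>power_exps\<close>) consist of the
  exponents \<open>b + f\<^sub>1 + \<dots> + f\<^sub>k\<close> with all \<open>f\<^sub>i \<in> F\<close> and \<open>b\<close> arbitrary; then \<open>I\<^bsup>k\<^esup>\<close> is spanned by the
  monomials with exponent in \<open>E\<^sub>k\<close>. The property that links the two halves is decomposition: \<open>N e \<in> E\<^bsub>kN\<^esub>\<close> for some
  \<open>N \<ge> 1\<close> implies \<open>e \<in> E\<^sub>k\<close>.

  Algebra. Dickson's lemma shows that decomposition implies a stronger criterion, with a bounded
  excess \<open>d\<close>: if \<open>s e + d \<in> E\<^bsub>ks\<^esub>\<close> for all \<open>s\<close>, then \<open>e \<in> E\<^sub>k\<close> (\<open>exps_of_bounded_excess\<close>). An element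
  \<open>r\<close> that is integral over \<open>I\<^bsup>k\<^esup>\<close> satisfies \<open>r\<^bsup>s+L\<^esup> \<in> I\<^bsup>ks\<^esup>\<close> for a fixed \<open>L\<close>; comparing leading
  exponents puts its leading term into \<open>I\<^bsup>k\<^esup>\<close> by the criterion, and this term can be subtracted, so
  all terms of \<open>r\<close> lie in \<open>I\<^bsup>k\<^esup>\<close>. Strong persistence uses the same criterion: if \<open>e + f \<in> E\<^bsub>k+1\<^esub>\<close> for
  every \<open>f \<in> F\<close>, then \<open>s e + f \<in> E\<^bsub>ks+1\<^esub>\<close> by induction on \<open>s\<close>. Persistence follows from strong
  persistence in every commutative ring, for finitely generated ideals.

  Combinatorics. For a cycle, a vector is recorded by the partial sums of its periodic
  continuation. Dominating the cycle becomes a condition on differences of partial sums, namely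
  \<open>Y (j + 3) \<ge> Y j + 1\<close>, and rounding down preserves lower bounds on differences by integers.
  Hence a rational splitting of a staircase can be rounded to an integral one
  (\<open>staircase_split\<close>), as long as the total sums of the two parts are integers. This
  condition is an obstruction because dominating sets have different sizes. It is overcome in
  \<open>cycle_decomposition\<close>: the given dominating sets are divided into small and large ones around
  the average size, and the two groups are mixed with rational weights so that the average sizes of
  the mixtures become two consecutive integers.
\<close>

section \<open>Exponents of the powers of a monomial ideal\<close>

text \<open>The exponents of the monomials in the \<open>k\<close>-th power of the ideal generated by the monomials
  with exponents in \<open>F\<close>.\<close>

definition power_exps :: "'v set \<Rightarrow> ('v \<Rightarrow>\<^sub>0 nat) set \<Rightarrow> nat \<Rightarrow> ('v \<Rightarrow>\<^sub>0 nat) set" where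
  "power_exps V F k =
     {b + sum_mset A | b A. Poly_Mapping.keys b \<subseteq> V \<and> set_mset A \<subseteq> F \<and> size A = k}"

primrec nsmul :: "nat \<Rightarrow> ('v \<Rightarrow>\<^sub>0 nat) \<Rightarrow> ('v \<Rightarrow>\<^sub>0 nat)" where
  "nsmul 0 e = 0"
| "nsmul (Suc s) e = e + nsmul s e"

lemma lookup_nsmul: "Poly_Mapping.lookup (nsmul s e) v = s * Poly_Mapping.lookup e v"
  by (induction s) (simp_all add: lookup_add)

lemma nsmul_add: "nsmul (s + t) e = nsmul s e + nsmul t e"
  by (induction s) (simp_all add: algebra_simps)

lemma keys_add_nat:
  "Poly_Mapping.keys (a + b) = Poly_Mapping.keys a \<union> Poly_Mapping.keys (b :: 'v \<Rightarrow>\<^sub>0 nat)"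
  by (auto simp: in_keys_iff lookup_add)

lemma power_exps_times_monomial:
  assumes "e \<in> power_exps V F k" "Poly_Mapping.keys b \<subseteq> V"
  shows "b + e \<in> power_exps V F k"
proof -
  obtain c A where "e = c + sum_mset A" "Poly_Mapping.keys c \<subseteq> V" "set_mset A \<subseteq> F" "size A = k"
    using assms(1) by (auto simp: power_exps_def)
  then show ?thesis
    using assms(2) unfolding power_exps_def
    by (intro CollectI exI[of _ "b + c"] exI[of _ A]) (auto simp: keys_add_nat algebra_simps)
qed

lemma power_exps_add:
  assumes "e \<in> power_exps V F k" "f \<in> power_exps V F l"
  shows "e + f \<in> power_exps V F (k + l)"
proof -
  obtain b A where 1: "e = b + sum_mset A" "Poly_Mapping.keys b \<subseteq> V" "set_mset A \<subseteq> F" "size A = k"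
    using assms(1) by (auto simp: power_exps_def)
  obtain c B where 2: "f = c + sum_mset B" "Poly_Mapping.keys c \<subseteq> V" "set_mset B \<subseteq> F" "size B = l"
    using assms(2) by (auto simp: power_exps_def)
  show ?thesis
    using 1 2 unfolding power_exps_def
    by (intro CollectI exI[of _ "b + c"] exI[of _ "A + B"]) (auto simp: keys_add_nat algebra_simps)
qed

lemma generator_in_power_exps: "f \<in> F \<Longrightarrow> f \<in> power_exps V F 1"
  unfolding power_exps_def by (intro CollectI exI[of _ 0] exI[of _ "{#f#}"]) auto

lemma power_exps_SucE:
  assumes "e \<in> power_exps V F (Suc k)"
  obtains f g where "f \<in> F" "g \<in> power_exps V F k" "e = f + g"
proof -
  obtain b A where 1: "e = b + sum_mset A" "Poly_Mapping.keys b \<subseteq> V" "set_mset A \<subseteq> F" "size A = Suc k"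
    using assms by (auto simp: power_exps_def)
  obtain f B where "A = add_mset f B"
    using 1 by (metis size_Suc_Diff1 nat.simps(3) size_empty multi_nonempty_split)
  then show ?thesis
    using 1 by (intro that[of f "b + sum_mset B"]) (auto simp: power_exps_def algebra_simps)
qed

lemma power_exps_split:
  assumes "e \<in> power_exps V F (k + l)"
  obtains f g where "f \<in> power_exps V F k" "g \<in> power_exps V F l" "e = f + g"
  using assms
proof (induction k arbitrary: e thesis)
  case 0
  then show ?case
    by (intro "0.prems"(1)[of 0 e]) (auto simp: power_exps_def)
next
  case (Suc k)
  then obtain f g where fg: "f \<in> F" "g \<in> power_exps V F (k + l)" "e = f + g"
    by (auto elim: power_exps_SucE)
  obtain a b where ab: "a \<in> power_exps V F k" "b \<in> power_exps V F l" "g = a + b"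
    using Suc.IH fg(2) by blast
  have "f + a \<in> power_exps V F (Suc k)"
    using power_exps_add[OF generator_in_power_exps[OF fg(1)] ab(1)] by simp
  then show ?case
    using Suc.prems(1) ab fg by (metis add.assoc)
qed

text \<open>Dickson's lemma, in the form that is proved most directly: a sequence in \<open>\<nat>\<^bsup>I\<^esup>\<close> has a
  subsequence that increases in every coordinate, obtained by thinning out one coordinate at a
  time.\<close>

lemma dickson:
  fixes h :: "nat \<Rightarrow> 'i \<Rightarrow> nat"
  assumes "finite I"
  shows "\<exists>\<phi>. strict_mono (\<phi> :: nat \<Rightarrow> nat) \<and> (\<forall>i\<in>I. mono (\<lambda>n. h (\<phi> n) i))"
  using assms
proof (induction I rule: finite_induct)
  case empty
  show ?case by (auto intro!: exI[of _ id] simp: strict_mono_def)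
next
  case (insert j I)
  then obtain \<phi> :: "nat \<Rightarrow> nat" where \<phi>: "strict_mono \<phi>" "\<forall>i\<in>I. mono (\<lambda>n. h (\<phi> n) i)"
    by blast
  obtain \<psi> :: "nat \<Rightarrow> nat" where \<psi>: "strict_mono \<psi>" "monoseq (\<lambda>n. h (\<phi> (\<psi> n)) j)"
    using seq_monosub[of "\<lambda>n. h (\<phi> n) j"] by blast
  have "\<exists>\<chi>. strict_mono (\<chi> :: nat \<Rightarrow> nat) \<and> mono (\<lambda>n. h (\<phi> (\<chi> n)) j)"
  proof (cases "mono (\<lambda>n. h (\<phi> (\<psi> n)) j)")
    case True
    with \<psi> show ?thesis by blast
  next
    case False
    \<comment> \<open>A decreasing sequence of natural numbers is constant from the place of its minimum on.\<close>
    then have dec: "h (\<phi> (\<psi> n)) j \<le> h (\<phi> (\<psi> m)) j" if "m \<le> n" for m n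
      using \<psi>(2) that by (auto simp: monoseq_def mono_def)
    obtain n0 where "\<And>n. h (\<phi> (\<psi> n0)) j \<le> h (\<phi> (\<psi> n)) j"
      using ex_has_least_nat[of "\<lambda>_. True" _ "\<lambda>n. h (\<phi> (\<psi> n)) j"] by blast
    with dec have "h (\<phi> (\<psi> (n0 + n))) j = h (\<phi> (\<psi> n0)) j" for n
      by (simp add: antisym)
    then show ?thesis
      using \<psi>(1) by (intro exI[of _ "\<lambda>n. \<psi> (n0 + n)"]) (auto simp: strict_mono_def mono_def)
  qed
  then obtain \<chi> :: "nat \<Rightarrow> nat" where \<chi>: "strict_mono \<chi>" "mono (\<lambda>n. h (\<phi> (\<chi> n)) j)"
    by blast
  have "strict_mono (\<lambda>n. \<phi> (\<chi> n))"
    using \<phi>(1) \<chi>(1) by (simp add: strict_mono_def)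
  moreover have "mono (\<lambda>n. h (\<phi> (\<chi> n)) i)" if "i \<in> I" for i
    using \<phi>(2) that \<chi>(1) by (auto simp: mono_def strict_mono_less_eq)
  ultimately show ?case
    using \<chi>(2) by (intro exI[of _ "\<lambda>n. \<phi> (\<chi> n)"]) auto
qed

text \<open>Write \<open>s e + d\<close> as a sum of \<open>k s\<close> generators and a remainder. By Dickson's lemma some
  two of these representations, for \<open>s < t\<close>, are comparable term by term. In their difference the
  excess \<open>d\<close> cancels, and what is left represents \<open>(t - s) e\<close> by \<open>k (t - s)\<close> generators.\<close>

lemma power_exps_of_bounded_excess:
  fixes e d :: "'v \<Rightarrow>\<^sub>0 nat"
  assumes "finite V" "finite F" and "\<And>s. nsmul s e + d \<in> power_exps V F (k * s)"
  shows "\<exists>N\<ge>1. nsmul N e \<in> power_exps V F (k * N)"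
proof -
  have "\<forall>s. \<exists>b A. nsmul s e + d = b + sum_mset A \<and> Poly_Mapping.keys b \<subseteq> V \<and> set_mset A \<subseteq> F
          \<and> size A = k * s"
    using assms(3) by (auto simp: power_exps_def)
  then obtain b A where bA: "\<And>s. nsmul s e + d = b s + sum_mset (A s)"
      "\<And>s. Poly_Mapping.keys (b s) \<subseteq> V" "\<And>s. set_mset (A s) \<subseteq> F" "\<And>s. size (A s) = k * s"
    by metis
  \<comment> \<open>One coordinate for each entry of the remainder and one for each multiplicity.\<close>
  define h :: "nat \<Rightarrow> 'v + ('v \<Rightarrow>\<^sub>0 nat) \<Rightarrow> nat" where
    "h s = case_sum (Poly_Mapping.lookup (b s)) (count (A s))" for s
  obtain \<phi> :: "nat \<Rightarrow> nat" where \<phi>: "strict_mono \<phi>" "\<forall>i\<in>V <+> F. mono (\<lambda>n. h (\<phi> n) i)"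
    using dickson[of "V <+> F" h] assms(1,2) by auto
  define s t where "s = \<phi> 0" and "t = \<phi> 1"
  have "s < t"
    using \<phi>(1) by (simp add: s_def t_def strict_mono_def)
  have le: "h s i \<le> h t i" if "i \<in> V <+> F" for i
    using \<phi>(2) that by (auto simp: s_def t_def mono_def)
  have "count (A s) f \<le> count (A t) f" for f
    using le[of "Inr f"] bA(3)[of s]
    by (cases "f \<in> F") (auto simp: h_def dest: count_eq_zero_iff[THEN iffD2, OF contra_subsetD])
  then have A: "A t = A s + (A t - A s)"
    by (simp add: subseteq_mset_def)
  have "Poly_Mapping.lookup (b s) v \<le> Poly_Mapping.lookup (b t) v" for v
    using le[of "Inl v"] bA(2)[of s] by (cases "v \<in> Poly_Mapping.keys (b s)") (auto simp: h_def not_in_keys_iff_lookup_eq_zero)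
  then have b: "b t = b s + (b t - b s)"
    by (intro poly_mapping_eqI) (simp add: lookup_add lookup_minus)
  have "nsmul t e = nsmul s e + nsmul (t - s) e"
    using \<open>s < t\<close> by (simp flip: nsmul_add)
  with bA(1)[of t] A b
  have "(nsmul s e + d) + nsmul (t - s) e = (b s + (b t - b s)) + (sum_mset (A s) + sum_mset (A t - A s))"
    by (metis add.assoc add.commute sum_mset.union)
  then have "(nsmul s e + d) + nsmul (t - s) e = (nsmul s e + d) + ((b t - b s) + sum_mset (A t - A s))"
    unfolding bA(1)[of s] by (simp add: algebra_simps)
  then have "nsmul (t - s) e = (b t - b s) + sum_mset (A t - A s)"
    by simp
  moreover have "Poly_Mapping.keys (b t - b s) \<subseteq> V"
    using bA(2)[of t] by (auto simp: in_keys_iff lookup_minus)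
  moreover have "set_mset (A t - A s) \<subseteq> F"
    using bA(3)[of t] by (meson in_diffD subset_iff)
  moreover have "size (A t - A s) = k * (t - s)"
    using A bA(4) by (metis add_diff_cancel_left' size_union diff_mult_distrib2)
  ultimately have "nsmul (t - s) e \<in> power_exps V F (k * (t - s))"
    unfolding power_exps_def by blast
  with \<open>s < t\<close> show ?thesis
    by (intro exI[of _ "t - s"]) auto
qed

section \<open>Monomial ideals and their powers\<close>

definition monomial_span :: "('v \<Rightarrow>\<^sub>0 nat) set \<Rightarrow> ('v, 'k::field) mpoly set" where
  "monomial_span E = {p. Poly_Mapping.keys p \<subseteq> E}"

lemma mpoly_ring_simps [simp]:
  "p \<otimes>\<^bsub>mpoly_ring V\<^esub> q = p * q" "p \<oplus>\<^bsub>mpoly_ring V\<^esub> q = p + q"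
  "\<zero>\<^bsub>mpoly_ring V\<^esub> = 0" "\<one>\<^bsub>mpoly_ring V\<^esub> = 1"
  by (simp_all add: mpoly_ring_def)

lemma carrier_mpoly_ring: "carrier (mpoly_ring V) = monomial_span (power_exps V F 0)"
proof -
  have "power_exps V F 0 = {e. Poly_Mapping.keys e \<subseteq> V}"
    by (auto simp: power_exps_def)
  then show ?thesis by (auto simp: mpoly_ring_def monomial_span_def)
qed

lemma mpoly_ring_pow: "p [^]\<^bsub>mpoly_ring V\<^esub> (m::nat) = p ^ m"
  by (induction m) (simp_all add: mult.commute)

lemma mpoly_ring_uminus:
  assumes "p \<in> carrier (mpoly_ring V)"
  shows "\<ominus>\<^bsub>mpoly_ring V\<^esub> p = - (p :: ('v, 'k::field) mpoly)"
proof -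
  interpret cring "mpoly_ring V :: ('v, 'k) mpoly ring" by (rule cring_mpoly_ring)
  show ?thesis
    using assms by (intro minus_equality) (auto simp: mpoly_ring_def)
qed

lemma mpoly_ring_finsum:
  assumes "finite A" "\<And>i. i \<in> A \<Longrightarrow> f i \<in> carrier (mpoly_ring V)"
  shows "(\<Oplus>\<^bsub>mpoly_ring V\<^esub> i\<in>A. f i) = (\<Sum>i\<in>A. f i :: ('v, 'k::field) mpoly)"
proof -
  interpret cring "mpoly_ring V :: ('v, 'k) mpoly ring" by (rule cring_mpoly_ring)
  show ?thesis
    using assms by (induction A rule: finite_induct) (simp_all add: Pi_def)
qed

lemma monomial_span_mult:
  assumes "p \<in> monomial_span (power_exps V F k)" "q \<in> monomial_span (power_exps V F l)"
  shows "p * q \<in> monomial_span (power_exps V F (k + l))"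
  using assms keys_mult[of p q] power_exps_add[of _ V F k _ l]
  by (fastforce simp: monomial_span_def)

lemma monomial_span_add:
  "p \<in> monomial_span E \<Longrightarrow> q \<in> monomial_span E \<Longrightarrow> p + q \<in> monomial_span E"
  using Poly_Mapping.keys_add[of p q] by (auto simp: monomial_span_def)

lemma monomial_span_uminus: "p \<in> monomial_span E \<Longrightarrow> - p \<in> monomial_span E"
  by (simp add: monomial_span_def)

lemma monomial_span_zero: "0 \<in> monomial_span E"
  by (simp add: monomial_span_def)

lemma monomial_span_sum:
  "(\<And>i. i \<in> A \<Longrightarrow> f i \<in> monomial_span E) \<Longrightarrow> (\<Sum>i\<in>A. f i) \<in> monomial_span E"
  by (induction A rule: infinite_finite_induct) (auto intro: monomial_span_zero monomial_span_add)

lemma sum_monomials: "p = (\<Sum>m\<in>Poly_Mapping.keys p. Poly_Mapping.single m (Poly_Mapping.lookup p m))"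
  by (rule poly_mapping_eqI)
    (auto simp: lookup_sum lookup_single when_def in_keys_iff)

lemma monomial_split:
  fixes p :: "('v, 'k::field) mpoly"
  assumes "e \<in> Poly_Mapping.keys p"
  obtains p' where "p = Poly_Mapping.single e (Poly_Mapping.lookup p e) + p'"
    "Poly_Mapping.keys p' = Poly_Mapping.keys p - {e}"
proof (rule that[of "p - Poly_Mapping.single e (Poly_Mapping.lookup p e)"])
  show "Poly_Mapping.keys (p - Poly_Mapping.single e (Poly_Mapping.lookup p e)) = Poly_Mapping.keys p - {e}"
    by (auto simp: in_keys_iff lookup_minus lookup_single when_def split: if_splits)
qed simp

lemma lookup_times_monomial:
  fixes p :: "('v, 'k::field) mpoly"
  shows "Poly_Mapping.lookup (p * Poly_Mapping.single f c) (e + f) = Poly_Mapping.lookup p e * c"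
proof (cases "e \<in> Poly_Mapping.keys p")
  case True
  then obtain p' where p': "p = Poly_Mapping.single e (Poly_Mapping.lookup p e) + p'"
    "Poly_Mapping.keys p' = Poly_Mapping.keys p - {e}" by (rule monomial_split)
  have "e + f \<notin> Poly_Mapping.keys (p' * Poly_Mapping.single f c)"
    using keys_mult[of p' "Poly_Mapping.single f c"] p'(2) by (auto split: if_splits)
  then show ?thesis
    by (subst p'(1)) (simp add: distrib_right lookup_add mult_single in_keys_iff)
next
  case False
  then have "e + f \<notin> Poly_Mapping.keys (p * Poly_Mapping.single f c)"
    using keys_mult[of p "Poly_Mapping.single f c"] by (auto split: if_splits)
  with False show ?thesis by (simp add: in_keys_iff)
qed

text \<open>The linear order on exponents is the lexicographic one that comes with the type of finitely
  supported maps. It is compatible with addition, so it serves as a monomial order.\<close>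

lemma leading_term_times:
  fixes p q :: "('v::linorder, 'k::field) mpoly"
  assumes "\<And>m. m \<in> Poly_Mapping.keys p \<Longrightarrow> m \<le> a" "\<And>m. m \<in> Poly_Mapping.keys q \<Longrightarrow> m \<le> b"
  shows "Poly_Mapping.lookup (p * q) (a + b) = Poly_Mapping.lookup p a * Poly_Mapping.lookup q b"
    and "\<And>m. m \<in> Poly_Mapping.keys (p * q) \<Longrightarrow> m \<le> a + b"
proof -
  show "m \<le> a + b" if "m \<in> Poly_Mapping.keys (p * q)" for m
    using that keys_mult[of p q] assms by (auto intro: add_mono)
  show "Poly_Mapping.lookup (p * q) (a + b) = Poly_Mapping.lookup p a * Poly_Mapping.lookup q b"
  proof (cases "b \<in> Poly_Mapping.keys q")
    case True
    then obtain q' where q': "q = Poly_Mapping.single b (Poly_Mapping.lookup q b) + q'"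
      "Poly_Mapping.keys q' = Poly_Mapping.keys q - {b}" by (rule monomial_split)
    have "m + n \<noteq> a + b" if "m \<in> Poly_Mapping.keys p" "n \<in> Poly_Mapping.keys q'" for m n
      using assms(1)[OF that(1)] assms(2)[of n] that(2) q'(2)
      by (metis DiffD1 DiffD2 add_le_less_mono insertI1 less_irrefl order_less_le)
    then have "a + b \<notin> Poly_Mapping.keys (p * q')"
      using keys_mult[of p q'] by fastforce
    then have "Poly_Mapping.lookup (p * q') (a + b) = 0"
      by (simp add: in_keys_iff)
    then show ?thesis
      by (subst q'(1)) (simp add: distrib_left lookup_add lookup_times_monomial)
  next
    case False
    have "m + n \<noteq> a + b" if "m \<in> Poly_Mapping.keys p" "n \<in> Poly_Mapping.keys q" for m n
      using assms(1)[OF that(1)] assms(2)[OF that(2)] that(2) False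
      by (metis add_le_less_mono less_irrefl order_less_le)
    then have "a + b \<notin> Poly_Mapping.keys (p * q)"
      using keys_mult[of p q] by fastforce
    with False show ?thesis
      by (simp add: in_keys_iff)
  qed
qed

lemma leading_term_power:
  fixes p :: "('v::linorder, 'k::field) mpoly"
  assumes "\<And>m. m \<in> Poly_Mapping.keys p \<Longrightarrow> m \<le> a"
  shows "Poly_Mapping.lookup (p ^ s) (nsmul s a) = Poly_Mapping.lookup p a ^ s
    \<and> (\<forall>m\<in>Poly_Mapping.keys (p ^ s). m \<le> nsmul s a)"
proof (induction s)
  case 0
  then show ?case by (auto simp: lookup_one)
next
  case (Suc s)
  then show ?case
    using leading_term_times[of p a "p ^ s" "nsmul s a"] assms by auto
qed

locale monomial_generators =
  fixes V :: "'v set" and F :: "('v \<Rightarrow>\<^sub>0 nat) set"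
  assumes finite_vars: "finite V"
    and finite_gens: "finite F"
    and keys_gens: "f \<in> F \<Longrightarrow> Poly_Mapping.keys f \<subseteq> V"
begin

abbreviation exps :: "nat \<Rightarrow> ('v \<Rightarrow>\<^sub>0 nat) set" where
  "exps k \<equiv> power_exps V F k"

abbreviation gen_ideal :: "('v, 'k::field) mpoly set" where
  "gen_ideal \<equiv> Idl\<^bsub>mpoly_ring V\<^esub> ((\<lambda>f. Poly_Mapping.single f 1) ` F)"

lemma keys_exps: "e \<in> exps k \<Longrightarrow> Poly_Mapping.keys e \<subseteq> V"
proof (induction k arbitrary: e)
  case 0
  then show ?case by (auto simp: power_exps_def)
next
  case (Suc k)
  then show ?case
    using keys_gens by (auto elim!: power_exps_SucE simp: keys_add_nat) blast+
qed

lemma exps_antimono: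
  assumes "l \<le> k"
  shows "exps k \<subseteq> exps l"
proof
  fix e assume "e \<in> exps k"
  then obtain f g where "f \<in> exps (k - l)" "g \<in> exps l" "e = f + g"
    using power_exps_split[of e V F "k - l" l] assms by auto
  then show "e \<in> exps l"
    using power_exps_times_monomial keys_exps by blast
qed

lemma monomial_span_subset_carrier: "monomial_span (exps k) \<subseteq> carrier (mpoly_ring V)"
  using exps_antimono[of 0 k] by (auto simp: carrier_mpoly_ring[of V F] monomial_span_def)

lemma ideal_monomial_span:
  "ideal (monomial_span (exps k) :: ('v, 'k::field) mpoly set) (mpoly_ring V)"
proof -
  let ?R = "mpoly_ring V :: ('v, 'k) mpoly ring"
  interpret cring ?R by (rule cring_mpoly_ring)
  have carr: "p \<in> carrier ?R" if "p \<in> monomial_span (exps k)" for p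
    using that monomial_span_subset_carrier by blast
  have l: "q * p \<in> monomial_span (exps k)"
    if "p \<in> monomial_span (exps k)" "q \<in> carrier ?R" for p q :: "('v, 'k) mpoly"
    using that monomial_span_mult[of q V F 0 p k] by (simp add: carrier_mpoly_ring[of V F])
  show ?thesis
  proof (rule idealI)
    show "subgroup (monomial_span (exps k)) (add_monoid ?R)"
    proof (rule group.subgroupI)
      show "group (add_monoid ?R)" by (rule add.is_group)
      fix p :: "('v, 'k) mpoly" assume p: "p \<in> monomial_span (exps k)"
      show "inv\<^bsub>add_monoid ?R\<^esub> p \<in> monomial_span (exps k)"
        using mpoly_ring_uminus[OF carr[OF p]] monomial_span_uminus[OF p]
        by (simp add: a_inv_def)
    qed (use carr monomial_span_zero[of "exps k"] in \<open>auto intro: monomial_span_add\<close>)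
  qed (use l in \<open>auto simp: ring_axioms mult.commute\<close>)
qed

lemma ideal_prod_monomial_span:
  "ideal_prod (mpoly_ring V) (monomial_span (exps k)) (monomial_span (exps l))
     = (monomial_span (exps (k + l)) :: ('v, 'k::field) mpoly set)" (is "?P = ?M")
proof
  show "?P \<subseteq> ?M"
  proof
    fix p assume "p \<in> ?P"
    then show "p \<in> ?M"
      by induction (auto intro: monomial_span_mult monomial_span_add)
  qed
  show "?M \<subseteq> ?P"
  proof
    fix p assume p: "p \<in> ?M"
    have monomial: "Poly_Mapping.single e c \<in> ?P" if e: "e \<in> exps (k + l)" for e and c :: 'k
    proof -
      obtain f g where fg: "f \<in> exps k" "g \<in> exps l" "e = f + g"
        using power_exps_split[OF e] by blast
      have "Poly_Mapping.single f c \<otimes>\<^bsub>mpoly_ring V\<^esub> Poly_Mapping.single g 1 \<in> ?P"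
        using fg by (intro ideal_prod.prod) (auto simp: monomial_span_def)
      then show ?thesis by (simp add: fg(3) mult_single)
    qed
    have "(0 :: ('v, 'k) mpoly) \<otimes>\<^bsub>mpoly_ring V\<^esub> 0 \<in> ?P"
      by (intro ideal_prod.prod monomial_span_zero)
    then have zero: "0 \<in> ?P" by simp
    have "(\<Sum>m\<in>K. Poly_Mapping.single m (Poly_Mapping.lookup p m)) \<in> ?P"
      if "finite K" "K \<subseteq> exps (k + l)" for K
      using that
    proof (induction K rule: finite_induct)
      case empty
      show ?case using zero by simp
    next
      case (insert m K)
      then show ?case
        using ideal_prod.sum[OF monomial[of m "Poly_Mapping.lookup p m"], of "\<Sum>m\<in>K. Poly_Mapping.single m (Poly_Mapping.lookup p m)"]
        by simp
    qed
    from this[of "Poly_Mapping.keys p"] show "p \<in> ?P"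
      using p by (simp add: monomial_span_def flip: sum_monomials)
  qed
qed

lemma gen_ideal_eq: "gen_ideal = (monomial_span (exps 1) :: ('v, 'k::field) mpoly set)"
proof
  let ?R = "mpoly_ring V :: ('v, 'k) mpoly ring"
  let ?G = "(\<lambda>f. Poly_Mapping.single f 1) ` F :: ('v, 'k) mpoly set"
  interpret cring ?R by (rule cring_mpoly_ring)
  have sub: "?G \<subseteq> monomial_span (exps 1)"
    using generator_in_power_exps by (auto simp: monomial_span_def)
  then show "Idl\<^bsub>?R\<^esub> ?G \<subseteq> monomial_span (exps 1)"
    by (intro genideal_minimal ideal_monomial_span)
  have GR: "?G \<subseteq> carrier ?R"
    using sub monomial_span_subset_carrier by blast
  interpret I: ideal "Idl\<^bsub>?R\<^esub> ?G" ?R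
    by (rule genideal_ideal[OF GR])
  show "monomial_span (exps 1) \<subseteq> Idl\<^bsub>?R\<^esub> ?G"
  proof
    fix p :: "('v, 'k) mpoly" assume p: "p \<in> monomial_span (exps 1)"
    have monomial: "Poly_Mapping.single e c \<in> Idl\<^bsub>?R\<^esub> ?G" if e: "e \<in> exps 1" for e and c :: 'k
    proof -
      obtain f g where fg: "f \<in> F" "g \<in> exps 0" "e = f + g"
        using e by (auto elim: power_exps_SucE)
      have "Poly_Mapping.single g c \<otimes>\<^bsub>?R\<^esub> Poly_Mapping.single f 1 \<in> Idl\<^bsub>?R\<^esub> ?G"
        using genideal_self[OF GR] fg
        by (intro I.I_l_closed) (auto simp: carrier_mpoly_ring[of V F] monomial_span_def)
      then show ?thesis by (simp add: fg(3) mult_single add.commute)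
    qed
    have "(\<Sum>m\<in>K. Poly_Mapping.single m (Poly_Mapping.lookup p m)) \<in> Idl\<^bsub>?R\<^esub> ?G"
      if "finite K" "K \<subseteq> exps 1" for K
      using that
    proof (induction K rule: finite_induct)
      case empty
      show ?case using I.zero_closed by simp
    next
      case (insert m K)
      then show ?case
        using I.a_closed[OF monomial[of m "Poly_Mapping.lookup p m"], of "\<Sum>m\<in>K. Poly_Mapping.single m (Poly_Mapping.lookup p m)"]
        by simp
    qed
    from this[of "Poly_Mapping.keys p"] show "p \<in> Idl\<^bsub>?R\<^esub> ?G"
      using p by (simp add: monomial_span_def flip: sum_monomials)
  qed
qed

lemma ideal_power_monomial_span:
  "ideal_power (mpoly_ring V) (monomial_span (exps k)) i
     = (monomial_span (exps (k * i)) :: ('v, 'k::field) mpoly set)"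
proof (induction i)
  case 0
  show ?case by (simp add: ideals_set_def flip: carrier_mpoly_ring)
next
  case (Suc i)
  have "ideal_power (mpoly_ring V) (monomial_span (exps k)) (Suc i)
      = ideal_prod (mpoly_ring V) (ideal_power (mpoly_ring V) (monomial_span (exps k)) i)
          (monomial_span (exps k) :: ('v, 'k) mpoly set)"
    by (simp add: ideals_set_def)
  then show ?case
    by (simp add: Suc.IH ideal_prod_monomial_span add.commute)
qed

end

section \<open>From the decomposition property to normality and persistence\<close>

text \<open>If no \<open>J\<close> lay inside \<open>P\<close>, a product of elements of the various \<open>J\<close> outside \<open>P\<close> would lie in
  the intersection but not in \<open>P\<close>. The carrier is
  intersected explicitly because the empty intersection is the whole type.\<close>

lemma prime_contains_Inter:
  assumes "primeideal P R" "finite \<J>" "\<And>J. J \<in> \<J> \<Longrightarrow> ideal J R" "carrier R \<inter> \<Inter>\<J> \<subseteq> P"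
  shows "\<exists>J\<in>\<J>. J \<subseteq> P"
  using assms(2-4)
proof (induction \<J> rule: finite_induct)
  case empty
  interpret primeideal P R by fact
  show ?case using empty(2) I_notcarr a_subset by auto
next
  case (insert J \<J>)
  interpret primeideal P R by fact
  show ?case
  proof (cases "J \<subseteq> P")
    case False
    then obtain a where a: "a \<in> J" "a \<notin> P" by blast
    have idJ: "ideal J R" using insert.prems(1) by blast
    have aR: "a \<in> carrier R" using ideal.Icarr[OF idJ a(1)] .
    have "carrier R \<inter> \<Inter>\<J> \<subseteq> P"
    proof
      fix b assume b: "b \<in> carrier R \<inter> \<Inter>\<J>"
      have "a \<otimes>\<^bsub>R\<^esub> b \<in> J"
        using ideal.I_r_closed[OF idJ a(1)] b by blast
      moreover have "a \<otimes>\<^bsub>R\<^esub> b \<in> K" if "K \<in> \<J>" for K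
        using ideal.I_l_closed[of K R b a] insert.prems(1) b aR that by blast
      ultimately have "a \<otimes>\<^bsub>R\<^esub> b \<in> P"
        using insert.prems(2) b m_closed[OF aR, of b] by blast
      then show "b \<in> P"
        using I_prime[OF aR _ \<open>a \<otimes>\<^bsub>R\<^esub> b \<in> P\<close>] a(2) b by blast
    qed
    with insert show ?thesis by blast
  qed auto
qed

context cring
begin

lemma ideal_colon_element:
  assumes "ideal J R" "x \<in> carrier R"
  shows "ideal {r \<in> carrier R. r \<otimes> x \<in> J} R"
proof -
  interpret J: ideal J R by fact
  have sub: "a \<ominus> b \<in> J" if "a \<in> J" "b \<in> J" for a b
    using that by (simp add: a_minus_def)
  show ?thesis
  proof (rule idealI)
    show "subgroup {r \<in> carrier R. r \<otimes> x \<in> J} (add_monoid R)"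
    proof (rule group.subgroupI)
      show "group (add_monoid R)" by (rule add.is_group)
      fix a assume a: "a \<in> {r \<in> carrier R. r \<otimes> x \<in> J}"
      show "inv\<^bsub>add_monoid R\<^esub> a \<in> {r \<in> carrier R. r \<otimes> x \<in> J}"
        using a assms(2) by (simp add: l_minus flip: a_inv_def)
      fix b assume b: "b \<in> {r \<in> carrier R. r \<otimes> x \<in> J}"
      show "a \<otimes>\<^bsub>add_monoid R\<^esub> b \<in> {r \<in> carrier R. r \<otimes> x \<in> J}"
        using a b assms(2) by (simp add: l_distr)
    qed (use assms(2) in \<open>auto intro: exI[of _ \<zero>]\<close>)
    fix a y assume a: "a \<in> {r \<in> carrier R. r \<otimes> x \<in> J}" and y: "y \<in> carrier R"
    have "y \<otimes> (a \<otimes> x) \<in> J"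
      using a y by (auto intro: J.I_l_closed)
    then show "y \<otimes> a \<in> {r \<in> carrier R. r \<otimes> x \<in> J}" "a \<otimes> y \<in> {r \<in> carrier R. r \<otimes> x \<in> J}"
      using a y assms(2) by (simp_all add: m_assoc m_comm[of a y])
  qed (rule ring_axioms)
qed

lemma Ass_quot_module:
  assumes "ideal J R"
  shows "P \<in> Ass R (quot_module R J)
    \<longleftrightarrow> primeideal P R \<and> (\<exists>x\<in>carrier R. P = {r \<in> carrier R. r \<otimes> x \<in> J})"
proof -
  interpret J: ideal J R by fact
  have carr: "carrier (quot_module R J) = {J +> x | x. x \<in> carrier R}"
    by (auto simp: quot_module_def ring.defs FactRing_def A_RCOSETS_def')
  have zero: "\<zero>\<^bsub>quot_module R J\<^esub> = J"
    by (simp add: quot_module_def ring.defs FactRing_def)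
  have eqJ: "J +> y = J \<longleftrightarrow> y \<in> J" if "y \<in> carrier R" for y
    using that J.rcos_const_imp_mem a_rcos_zero[OF assms] by blast
  have ann: "annihilator R (quot_module R J) (J +> x) = {r \<in> carrier R. r \<otimes> x \<in> J}"
    if "x \<in> carrier R" for x
    unfolding annihilator_def zero using that
    by (intro Collect_cong conj_cong refl) (simp only: quot_module_smult[OF assms] eqJ m_closed)
  have "(\<exists>X\<in>{J +> x | x. x \<in> carrier R}. P = annihilator R (quot_module R J) X)
      \<longleftrightarrow> (\<exists>x\<in>carrier R. P = annihilator R (quot_module R J) (J +> x))"
    by blast
  then show ?thesis
    unfolding Ass_def carr by (simp add: ann cong: bex_cong)
qed

text \<open>An associated prime \<open>(I\<^sup>k : x)\<close> equals \<open>(I\<^bsup>k+1\<^esup> : x I)\<close>, which is the intersection of the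
  finitely many ideals \<open>(I\<^bsup>k+1\<^esup> : x g)\<close>, one for each generator \<open>g\<close>; being prime, it is one of them.\<close>

lemma persistence_of_strong_persistence:
  assumes "finite G" "G \<subseteq> carrier R"
    and "\<And>k. ideal (ideal_power R (Idl G) k) R"
    and "strong_persistence_property R (Idl G)"
  shows "persistence_property R (Idl G)"
  unfolding persistence_property_def
proof (intro allI impI subsetI)
  fix k P
  let ?I = "ideal_power R (Idl G)"
  assume k: "1 \<le> (k::nat)" and "P \<in> Ass R (quot_module R (?I k))"
  then obtain x where P: "primeideal P R" "x \<in> carrier R" "P = {r \<in> carrier R. r \<otimes> x \<in> ?I k}"
    using Ass_quot_module[OF assms(3)] by blast
  have colon: "y \<in> ?I k \<longleftrightarrow> y \<in> carrier R \<and> (\<forall>s\<in>Idl G. y \<otimes> s \<in> ?I (k + 1))" for y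
    using assms(4) k by (auto simp: strong_persistence_property_def ideal_colon_def)
  define J where "J g = {r \<in> carrier R. r \<otimes> (x \<otimes> g) \<in> ?I (k + 1)}" for g
  have idJ: "ideal (J g) R" if "g \<in> G" for g
    unfolding J_def using that assms(2) P(2) by (intro ideal_colon_element assms(3)) auto
  have PJ: "P \<subseteq> J g" if "g \<in> G" for g
  proof
    fix r assume "r \<in> P"
    then have r: "r \<in> carrier R" "r \<otimes> x \<in> ?I k" using P(3) by auto
    have "(r \<otimes> x) \<otimes> g \<in> ?I (k + 1)"
      using colon r(2) genideal_self[OF assms(2)] that by blast
    then show "r \<in> J g"
      using r(1) P(2) that assms(2) by (auto simp: J_def m_assoc subset_iff)
  qed
  have "carrier R \<inter> \<Inter>(J ` G) \<subseteq> P"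
  proof
    fix r assume r: "r \<in> carrier R \<inter> \<Inter>(J ` G)"
    then have rR: "r \<in> carrier R" by blast
    let ?K = "{s \<in> carrier R. s \<otimes> (r \<otimes> x) \<in> ?I (k + 1)}"
    have "g \<in> ?K" if "g \<in> G" for g
    proof -
      have "g \<in> carrier R" "r \<otimes> (x \<otimes> g) \<in> ?I (k + 1)"
        using r that assms(2) by (auto simp: J_def)
      then show ?thesis
        using rR P(2) by (simp add: m_ac)
    qed
    then have "Idl G \<subseteq> ?K"
      using rR P(2) by (intro genideal_minimal ideal_colon_element assms(3)) auto
    then have "\<forall>s\<in>Idl G. (r \<otimes> x) \<otimes> s \<in> ?I (k + 1)"
      using rR P(2) by (auto simp: subset_iff m_comm)
    then have "r \<otimes> x \<in> ?I k"
      using colon rR P(2) by simp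
    with rR show "r \<in> P" by (simp add: P(3))
  qed
  then obtain g where g: "g \<in> G" "J g \<subseteq> P"
    using prime_contains_Inter[OF P(1), of "J ` G"] assms(1) idJ by auto
  then have "P = J g" using PJ by blast
  then show "P \<in> Ass R (quot_module R (?I (k + 1)))"
    using Ass_quot_module[OF assms(3)] P(1,2) g(1) assms(2) unfolding J_def by blast
qed

end

text \<open>In terms of the ideal: a monomial lies in its \<open>k\<close>-th power as soon as the \<open>N\<close>-th power of the
  monomial lies in the \<open>k N\<close>-th one. The order on the variables serves to choose leading terms.\<close>

locale decomposable_generators = monomial_generators V F
  for V :: "'v::linorder set" and F +
  assumes gens_nonempty: "F \<noteq> {}"
    and decomposition: "N \<ge> 1 \<Longrightarrow> nsmul N e \<in> power_exps V F (k * N) \<Longrightarrow> e \<in> power_exps V F k"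
begin

lemma exps_of_bounded_excess:
  assumes "\<And>s. nsmul s e + d \<in> exps (k * s)"
  shows "e \<in> exps k"
  using power_exps_of_bounded_excess[OF finite_vars finite_gens assms] decomposition by blast

text \<open>An equation of integral dependence of degree \<open>m\<close> expresses \<open>r\<^bsup>t\<^esup>\<close> through terms
  \<open>a\<^sub>i r\<^bsup>t-i\<^esup>\<close> with \<open>a\<^sub>i\<close> in the \<open>i\<close>-th power, so the defect \<open>m\<close> never grows. Unlike the
  equation itself, this consequence is easily seen to survive subtraction of an element of the
  ideal.\<close>

lemma powers_of_integral_element:
  fixes r :: "('v, 'k::field) mpoly"
  assumes "r \<in> carrier (mpoly_ring V)"
    and "integral_over_ideal (mpoly_ring V) (monomial_span (exps k)) r"
  obtains L where "\<And>t. r ^ t \<in> monomial_span (exps (k * (t - L)))"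
proof -
  let ?R = "mpoly_ring V :: ('v, 'k) mpoly ring"
  interpret cring ?R by (rule cring_mpoly_ring)
  obtain m a where m: "m \<ge> 1" and a: "\<And>i. i \<in> {1..m} \<Longrightarrow> a i \<in> monomial_span (exps (k * i))"
    and eq: "r [^]\<^bsub>?R\<^esub> m \<oplus>\<^bsub>?R\<^esub> (\<Oplus>\<^bsub>?R\<^esub> i\<in>{1..m}. a i \<otimes>\<^bsub>?R\<^esub> r [^]\<^bsub>?R\<^esub> (m - i)) = \<zero>\<^bsub>?R\<^esub>"
    using assms(2) unfolding integral_over_ideal_def ideal_power_monomial_span by blast
  have "a i \<in> carrier ?R" if "i \<in> {1..m}" for i
    using a[OF that] monomial_span_subset_carrier by blast
  then have "a i \<otimes>\<^bsub>?R\<^esub> r [^]\<^bsub>?R\<^esub> (m - i) \<in> carrier ?R" if "i \<in> {1..m}" for i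
    using that assms(1) by (intro m_closed nat_pow_closed)
  then have "(\<Oplus>\<^bsub>?R\<^esub> i\<in>{1..m}. a i \<otimes>\<^bsub>?R\<^esub> r [^]\<^bsub>?R\<^esub> (m - i)) = (\<Sum>i\<in>{1..m}. a i * r ^ (m - i))"
    by (subst mpoly_ring_finsum) (auto simp: mpoly_ring_pow)
  with eq have rm: "r ^ m = - (\<Sum>i\<in>{1..m}. a i * r ^ (m - i))"
    by (simp add: mpoly_ring_pow eq_neg_iff_add_eq_0)
  have "r ^ t \<in> monomial_span (exps (k * (t - m)))" for t
  proof (induction t rule: less_induct)
    case (less t)
    show ?case
    proof (cases "t \<le> m")
      case True
      have "r [^]\<^bsub>?R\<^esub> t \<in> carrier ?R"
        using assms(1) by (rule nat_pow_closed)
      with True show ?thesis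
        by (simp add: mpoly_ring_pow carrier_mpoly_ring[of V F])
    next
      case False
      then have "r ^ t = r ^ (t - m) * r ^ m"
        by (simp flip: power_add)
      also have "\<dots> = - (\<Sum>i\<in>{1..m}. a i * r ^ (t - i))"
        using False by (simp add: rm sum_distrib_left algebra_simps flip: power_add)
      finally have rt: "r ^ t = - (\<Sum>i\<in>{1..m}. a i * r ^ (t - i))" .
      have "a i * r ^ (t - i) \<in> monomial_span (exps (k * (t - m)))" if i: "i \<in> {1..m}" for i
      proof -
        have "a i * r ^ (t - i) \<in> monomial_span (exps (k * i + k * (t - i - m)))"
          using i False by (intro monomial_span_mult a less) auto
        moreover have "k * (t - m) \<le> k * (i + (t - i - m))"
          by (intro mult_le_mono2) linarith
        then have "k * (t - m) \<le> k * i + k * (t - i - m)"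
          by (simp add: add_mult_distrib2)
        ultimately show ?thesis
          using exps_antimono unfolding monomial_span_def by blast
      qed
      then show ?thesis
        unfolding rt by (intro monomial_span_uminus monomial_span_sum)
    qed
  qed
  then show thesis by (rule that)
qed

text \<open>The leading exponent of \<open>r\<^bsup>s+L\<^esup>\<close> is \<open>s + L\<close> times the leading exponent \<open>e\<close> of \<open>r\<close>, which
  is \<open>s e\<close> plus the fixed excess \<open>L e\<close>.\<close>

lemma leading_exponent_in_exps:
  fixes r :: "('v, 'k::field) mpoly"
  assumes "\<And>t. r ^ t \<in> monomial_span (exps (k * (t - L)))" and "r \<noteq> 0"
  shows "Max (Poly_Mapping.keys r) \<in> exps k"
proof (rule exps_of_bounded_excess)
  fix s
  define e where "e = Max (Poly_Mapping.keys r)"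
  have e: "e \<in> Poly_Mapping.keys r"
    using assms(2) unfolding e_def by (intro Max_in) auto
  have "Poly_Mapping.lookup (r ^ (s + L)) (nsmul (s + L) e) = Poly_Mapping.lookup r e ^ (s + L)"
    using leading_term_power[of r e "s + L"] unfolding e_def by simp
  also have "\<dots> \<noteq> 0"
    using e by (simp add: in_keys_iff)
  finally have "nsmul (s + L) e \<in> Poly_Mapping.keys (r ^ (s + L))"
    by (simp add: in_keys_iff)
  then show "nsmul s e + nsmul L e \<in> exps (k * s)"
    using assms(1)[of "s + L"] by (auto simp: monomial_span_def nsmul_add)
qed

lemma powers_minus_element:
  fixes r g :: "('v, 'k::field) mpoly"
  assumes "\<And>t. r ^ t \<in> monomial_span (exps (k * (t - L)))" and "g \<in> monomial_span (exps k)"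
  shows "(r - g) ^ t \<in> monomial_span (exps (k * (t - L)))"
proof -
  have g: "(- g) ^ i \<in> monomial_span (exps (k * i))" for i
  proof (induction i)
    case 0
    show ?case by (simp add: monomial_span_def power_exps_def)
  next
    case (Suc i)
    then show ?case
      using monomial_span_mult[OF monomial_span_uminus[OF assms(2)]] by simp
  qed
  have "of_nat (t choose i) * r ^ i * (- g) ^ (t - i) \<in> monomial_span (exps (k * (t - L)))"
    if "i \<le> t" for i
  proof -
    have "of_nat (t choose i) \<in> (monomial_span (exps 0) :: ('v, 'k) mpoly set)"
      by (auto simp: monomial_span_def power_exps_def in_keys_iff lookup_of_nat when_def split: if_splits)
    then have "of_nat (t choose i) * r ^ i * (- g) ^ (t - i)
        \<in> monomial_span (exps (0 + k * (i - L) + k * (t - i)))"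
      by (intro monomial_span_mult assms(1) g)
    moreover have "k * (t - L) \<le> k * ((i - L) + (t - i))"
      using that by (intro mult_le_mono2) linarith
    then have "k * (t - L) \<le> 0 + k * (i - L) + k * (t - i)"
      by (simp add: add_mult_distrib2)
    ultimately show ?thesis
      using exps_antimono unfolding monomial_span_def by blast
  qed
  then have "(r + - g) ^ t \<in> monomial_span (exps (k * (t - L)))"
    unfolding binomial_ring by (intro monomial_span_sum) auto
  then show ?thesis by simp
qed

text \<open>Leading terms are peeled off one at a time; the hypothesis is inherited by what is left.\<close>

lemma monomial_span_if_powers:
  fixes r :: "('v, 'k::field) mpoly"
  assumes "\<And>t. r ^ t \<in> monomial_span (exps (k * (t - L)))"
  shows "r \<in> monomial_span (exps k)"
  using assms
proof (induction "card (Poly_Mapping.keys r)" arbitrary: r rule: less_induct)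
  case less
  show ?case
  proof (cases "r = 0")
    case False
    define e where "e = Max (Poly_Mapping.keys r)"
    have e: "e \<in> Poly_Mapping.keys r"
      using False unfolding e_def by (intro Max_in) auto
    let ?g = "Poly_Mapping.single e (Poly_Mapping.lookup r e)"
    obtain r' where r': "r = ?g + r'" "Poly_Mapping.keys r' = Poly_Mapping.keys r - {e}"
      using e by (rule monomial_split)
    have "e \<in> exps k"
      unfolding e_def by (rule leading_exponent_in_exps[OF less.prems False])
    then have g: "?g \<in> monomial_span (exps k)"
      by (auto simp: monomial_span_def split: if_splits)
    have "r' = r - ?g"
      using r'(1) by (simp add: algebra_simps)
    moreover have "card (Poly_Mapping.keys r') < card (Poly_Mapping.keys r)"
      unfolding r'(2) using e by (intro card_Diff1_less) auto
    ultimately have "r' \<in> monomial_span (exps k)"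
      using less.hyps powers_minus_element[OF less.prems g] by blast
    with g r'(1) show ?thesis
      by (metis monomial_span_add)
  qed (simp add: monomial_span_zero)
qed

theorem normal_gen_ideal: "normal_ideal (mpoly_ring V) (gen_ideal :: ('v, 'k::field) mpoly set)"
  unfolding normal_ideal_def integrally_closed_ideal_def
proof (intro allI impI)
  fix k :: nat
  let ?R = "mpoly_ring V :: ('v, 'k) mpoly ring"
  let ?M = "monomial_span (exps k) :: ('v, 'k) mpoly set"
  interpret cring ?R by (rule cring_mpoly_ring)
  have "integral_over_ideal ?R ?M r" if r: "r \<in> ?M" for r
  proof -
    have "- r \<in> carrier ?R" and "r \<in> carrier ?R"
      using r monomial_span_uminus[OF r] monomial_span_subset_carrier by blast+
    moreover have "- r \<in> ideal_power ?R ?M 1"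
      unfolding ideal_power_monomial_span using monomial_span_uminus[OF r] by simp
    ultimately show ?thesis
      unfolding integral_over_ideal_def
      by (intro exI[of _ "1 :: nat"] exI[of _ "\<lambda>_. - r"]) (simp add: mpoly_ring_pow mpoly_ring_finsum)
  qed
  moreover have "r \<in> ?M" if "r \<in> carrier ?R" "integral_over_ideal ?R ?M r" for r
    using powers_of_integral_element[OF that] monomial_span_if_powers by metis
  ultimately have "integral_closure_ideal ?R ?M = ?M"
    using monomial_span_subset_carrier by (auto simp: integral_closure_ideal_def)
  then show "integral_closure_ideal ?R (ideal_power ?R gen_ideal k) = ideal_power ?R gen_ideal k"
    by (simp only: gen_ideal_eq ideal_power_monomial_span mult_1)
qed

text \<open>If \<open>r I \<subseteq> I\<^bsup>k+1\<^esup>\<close> and \<open>e\<close> is an exponent of \<open>r\<close>, then \<open>e + f \<in> E\<^bsub>k+1\<^esub>\<close> for all \<open>f \<in> F\<close>.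
  Splitting one generator \<open>f'\<close> off the right-hand side and adding \<open>e\<close> to it again gives, by
  induction, \<open>s e + f \<in> E\<^bsub>ks+1\<^esub>\<close>, and the criterion with excess \<open>f\<close> applies.\<close>

theorem strong_persistence_gen_ideal:
  "strong_persistence_property (mpoly_ring V) (gen_ideal :: ('v, 'k::field) mpoly set)"
  unfolding strong_persistence_property_def
proof (intro allI impI)
  fix k :: nat
  let ?R = "mpoly_ring V :: ('v, 'k) mpoly ring"
  let ?M = "\<lambda>k. monomial_span (exps k) :: ('v, 'k) mpoly set"
  have "r \<in> ?M k" if r: "r \<in> carrier ?R" "\<And>s. s \<in> ?M 1 \<Longrightarrow> r * s \<in> ?M (k + 1)" for r
    unfolding monomial_span_def
  proof (intro CollectI subsetI)
    fix e assume e: "e \<in> Poly_Mapping.keys r"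
    have step: "e + f \<in> exps (k + 1)" if f: "f \<in> F" for f
    proof -
      have "r * Poly_Mapping.single f 1 \<in> ?M (k + 1)"
        using generator_in_power_exps[OF f] by (intro r(2)) (auto simp: monomial_span_def)
      moreover have "e + f \<in> Poly_Mapping.keys (r * Poly_Mapping.single f 1)"
        using e by (simp add: in_keys_iff lookup_times_monomial)
      ultimately show ?thesis by (auto simp: monomial_span_def)
    qed
    have iter: "nsmul s e + f \<in> exps (k * s + 1)" if "f \<in> F" for s f
      using that
    proof (induction s arbitrary: f)
      case 0
      then show ?case using generator_in_power_exps by simp
    next
      case (Suc s)
      obtain f' h where "f' \<in> F" "h \<in> exps (k * s)" "nsmul s e + f = f' + h"
        using Suc.IH[OF Suc.prems] by (metis Suc_eq_plus1 power_exps_SucE)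
      then have "nsmul (Suc s) e + f = h + (e + f')"
        by (simp add: algebra_simps)
      also have "\<dots> \<in> exps (k * s + (k + 1))"
        using \<open>h \<in> _\<close> step[OF \<open>f' \<in> F\<close>] by (rule power_exps_add)
      finally show ?case by (simp add: algebra_simps)
    qed
    obtain f where "f \<in> F" using gens_nonempty by blast
    then show "e \<in> exps k"
      using iter[of f] exps_antimono[of "k * s" "k * s + 1" for s]
      by (intro exps_of_bounded_excess[of e f]) auto
  qed
  moreover have "r * s \<in> ?M (k + 1)" if "r \<in> ?M k" "s \<in> ?M 1" for r s
    using that by (rule monomial_span_mult)
  ultimately have "ideal_colon ?R (?M (k + 1)) (?M 1) = ?M k"
    using subsetD[OF monomial_span_subset_carrier[of k]] unfolding ideal_colon_def by auto
  then show "ideal_colon ?R (ideal_power ?R gen_ideal (k + 1)) gen_ideal = ideal_power ?R gen_ideal k"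
    by (simp only: gen_ideal_eq ideal_power_monomial_span mult_1)
qed

theorem persistence_gen_ideal:
  "persistence_property (mpoly_ring V) (gen_ideal :: ('v, 'k::field) mpoly set)"
proof (rule cring.persistence_of_strong_persistence[OF cring_mpoly_ring])
  show "(\<lambda>f. Poly_Mapping.single f 1) ` F \<subseteq> carrier (mpoly_ring V :: ('v, 'k) mpoly ring)"
    using keys_gens by (fastforce simp: mpoly_ring_def)
  show "ideal (ideal_power (mpoly_ring V) (gen_ideal :: ('v, 'k) mpoly set) k) (mpoly_ring V)" for k
    unfolding gen_ideal_eq ideal_power_monomial_span by (rule ideal_monomial_span)
qed (use finite_gens strong_persistence_gen_ideal in auto)

end

section \<open>Staircases\<close>

text \<open>Up to a constant, a staircase is the sequence of partial sums of a nonnegative \<open>n\<close>-periodic integer sequence with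
  sum \<open>m\<close> over a period and sum at least \<open>k\<close> over every window of length \<open>w\<close>. All three
  conditions concern differences, which makes them stable under rounding.\<close>

definition staircase :: "nat \<Rightarrow> nat \<Rightarrow> int \<Rightarrow> int \<Rightarrow> (nat \<Rightarrow> int) \<Rightarrow> bool" where
  "staircase n w k m Y \<longleftrightarrow>
     (\<forall>j. Y j \<le> Y (Suc j)) \<and> (\<forall>j. Y j + k \<le> Y (j + w)) \<and> (\<forall>j. Y (j + n) = Y j + m)"

lemma staircase_combination:
  assumes "staircase n w k m Y" "staircase n w k' m' Y'" "0 \<le> a" "0 \<le> b"
  shows "staircase n w (a * k + b * k') (a * m + b * m') (\<lambda>j. a * Y j + b * Y' j)"
  unfolding staircase_def
proof (intro conjI allI)
  fix j
  show "a * Y j + b * Y' j \<le> a * Y (Suc j) + b * Y' (Suc j)"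
    using assms by (intro add_mono mult_left_mono) (auto simp: staircase_def)
  have "a * (Y j + k) + b * (Y' j + k') \<le> a * Y (j + w) + b * Y' (j + w)"
    using assms by (intro add_mono mult_left_mono) (auto simp: staircase_def)
  then show "a * Y j + b * Y' j + (a * k + b * k') \<le> a * Y (j + w) + b * Y' (j + w)"
    by (simp add: algebra_simps)
  show "a * Y (j + n) + b * Y' (j + n) = a * Y j + b * Y' j + (a * m + b * m')"
    using assms by (simp add: staircase_def algebra_simps)
qed

lemma staircase_div:
  assumes "staircase n w (D * k) (D * m) Y" "D > 0"
  shows "staircase n w k m (\<lambda>j. (Y j + c) div D)"
  unfolding staircase_def
proof (intro conjI allI)
  fix j
  have shift: "(Y j + D * x + c) div D = (Y j + c) div D + x" for x
    using assms(2) div_mult_self2[of D "Y j + c" x] by (simp add: algebra_simps)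
  show "(Y j + c) div D \<le> (Y (Suc j) + c) div D"
    using assms by (intro zdiv_mono1) (auto simp: staircase_def)
  have "(Y j + D * k + c) div D \<le> (Y (j + w) + c) div D"
    using assms by (intro zdiv_mono1) (auto simp: staircase_def)
  then show "(Y j + c) div D + k \<le> (Y (j + w) + c) div D"
    by (simp add: shift)
  have "Y (j + n) = Y j + D * m"
    using assms by (simp add: staircase_def)
  then show "(Y (j + n) + c) div D = (Y j + c) div D + m"
    using shift by simp
qed

text \<open>\<open>A\<close> is the sum of the rational staircases \<open>U / D\<close> and \<open>U' / D\<close>. As \<open>A\<close> is integral, rounding
  the first down and the second up keeps the sum.\<close>

lemma staircase_split:
  assumes "D > 0" "staircase n w (D * k) (D * m) U" "staircase n w (D * k') (D * m') U'"
    and "\<And>j. U j + U' j = D * A j"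
  obtains B C where "\<And>j. A j = B j + C j" "staircase n w k m B" "staircase n w k' m' C"
proof (rule that)
  show "staircase n w k m (\<lambda>j. (U j + 0) div D)"
    using assms(2,1) by (rule staircase_div)
  show "staircase n w k' m' (\<lambda>j. (U' j + (D - 1)) div D)"
    using assms(3,1) by (rule staircase_div)
  fix j
  have "U' j + (D - 1) = (D - 1 - U j mod D) + D * (A j - U j div D)"
    using assms(4)[of j] mult_div_mod_eq[of D "U j"] by (simp add: algebra_simps)
  also have "\<dots> div D = (D - 1 - U j mod D) div D + (A j - U j div D)"
    using assms(1) by simp
  also have "(D - 1 - U j mod D) div D = 0"
    using assms(1) pos_mod_bound[of D "U j"] pos_mod_sign[of D "U j"]
    by (intro div_pos_pos_trivial) linarith+
  finally show "A j = (U j + 0) div D + (U' j + (D - 1)) div D"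
    by simp
qed

lemma staircase_step:
  assumes "staircase n w k m Y" "n > 0"
  shows "Y (Suc t) - Y t = Y (Suc (t mod n)) - Y (t mod n)"
proof (induction t rule: less_induct)
  case (less t)
  show ?case
  proof (cases "t < n")
    case False
    then obtain s where t: "t = s + n"
      by (metis add.commute le_iff_add not_less)
    then have "Y (Suc t) - Y t = Y (Suc s) - Y s"
      using assms(1) by (simp add: staircase_def flip: add_Suc)
    then show ?thesis
      using less[of s] t assms(2) by simp
  qed simp
qed

section \<open>Exponent vectors on a cycle\<close>

text \<open>Indices \<open>0, \<dots>, n - 1\<close> modulo \<open>n\<close> stand for the vertices \<open>1, \<dots>, n\<close>. Running over all natural
  numbers instead of one period turns the windows across the edge \<open>{n, 1}\<close> into ordinary ones.\<close>

definition partial_sums :: "nat \<Rightarrow> (nat \<Rightarrow>\<^sub>0 nat) \<Rightarrow> nat \<Rightarrow> int" where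
  "partial_sums n e j = (\<Sum>i<j. int (Poly_Mapping.lookup e (Suc (i mod n))))"

text \<open>On exponents supported in \<open>{1..n}\<close>, the inverse of \<open>partial_sums\<close>.\<close>

definition steps :: "nat \<Rightarrow> (nat \<Rightarrow> int) \<Rightarrow> nat \<Rightarrow>\<^sub>0 nat" where
  "steps n Y = (\<Sum>i<n. Poly_Mapping.single (Suc i) (nat (Y (Suc i) - Y i)))"

lemma partial_sums_add: "partial_sums n (e + f) j = partial_sums n e j + partial_sums n f j"
  by (simp add: partial_sums_def lookup_add sum.distrib)

lemma partial_sums_zero: "partial_sums n 0 j = 0"
  by (simp add: partial_sums_def)

lemma partial_sums_nsmul: "partial_sums n (nsmul s e) j = int s * partial_sums n e j"
  by (simp add: partial_sums_def lookup_nsmul sum_distrib_left)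

lemma partial_sums_nonneg: "0 \<le> partial_sums n e j"
  by (simp add: partial_sums_def sum_nonneg)

lemma partial_sums_Suc:
  "partial_sums n e (Suc j) = partial_sums n e j + int (Poly_Mapping.lookup e (Suc (j mod n)))"
  by (simp add: partial_sums_def)

lemma partial_sums_sum_mset_le:
  "(\<And>f. f \<in># A \<Longrightarrow> partial_sums n f j \<le> q) \<Longrightarrow> partial_sums n (sum_mset A) j \<le> int (size A) * q"
  by (induction A) (auto simp: partial_sums_add partial_sums_zero distrib_right add_mono)

lemma partial_sums_sum_mset_ge:
  "(\<And>f. f \<in># A \<Longrightarrow> q \<le> partial_sums n f j) \<Longrightarrow> int (size A) * q \<le> partial_sums n (sum_mset A) j"
  by (induction A) (auto simp: partial_sums_add partial_sums_zero distrib_right add_mono)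

lemma staircase_partial_sums: "staircase n w 0 (partial_sums n e n) (partial_sums n e)"
proof -
  have "partial_sums n e (j + n) = partial_sums n e j + partial_sums n e n" for j
    by (induction j) (auto simp: partial_sums_Suc, simp add: partial_sums_def)
  moreover have "partial_sums n e j \<le> partial_sums n e (j + w)" for j
    unfolding partial_sums_def by (intro sum_mono2) auto
  ultimately show ?thesis
    by (simp add: staircase_def partial_sums_Suc)
qed

lemma lookup_steps:
  "i < n \<Longrightarrow> Poly_Mapping.lookup (steps n Y) (Suc i) = nat (Y (Suc i) - Y i)"
  by (simp add: steps_def lookup_sum lookup_single when_def sum.delta)

lemma keys_steps: "Poly_Mapping.keys (steps n Y) \<subseteq> {1..n}"
proof
  fix v assume "v \<in> Poly_Mapping.keys (steps n Y)"
  then have "(\<Sum>i<n. Poly_Mapping.lookup (Poly_Mapping.single (Suc i) (nat (Y (Suc i) - Y i))) v) \<noteq> 0"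
    by (simp add: in_keys_iff steps_def lookup_sum)
  then obtain i where "i < n" "v = Suc i"
    by (metis (no_types, lifting) lessThan_iff lookup_single_not_eq sum.neutral)
  then show "v \<in> {1..n}" by simp
qed

lemma steps_partial_sums:
  assumes "Poly_Mapping.keys e \<subseteq> {1..n}"
  shows "steps n (partial_sums n e) = e"
proof (rule poly_mapping_eqI)
  fix v
  show "Poly_Mapping.lookup (steps n (partial_sums n e)) v = Poly_Mapping.lookup e v"
  proof (cases "v \<in> {1..n}")
    case True
    then obtain i where "v = Suc i" "i < n" by (cases v) auto
    then show ?thesis by (simp add: lookup_steps partial_sums_Suc)
  next
    case False
    then show ?thesis
      using assms keys_steps[of n "partial_sums n e"] by (metis in_keys_iff subsetD)
  qed
qed

lemma steps_add:
  assumes "staircase n w k m B" "staircase n w k' m' C"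
  shows "steps n (\<lambda>j. B j + C j) = steps n B + steps n C"
proof -
  have "nat (B (Suc i) + C (Suc i) - (B i + C i)) = nat (B (Suc i) - B i) + nat (C (Suc i) - C i)" for i
    using assms nat_add_distrib[of "B (Suc i) - B i" "C (Suc i) - C i"]
    by (simp add: staircase_def algebra_simps)
  then show ?thesis
    by (simp add: steps_def single_add sum.distrib)
qed

section \<open>The dominating ideal of a cycle\<close>

definition set_exp :: "'v set \<Rightarrow> 'v \<Rightarrow>\<^sub>0 nat" where
  "set_exp S = (\<Sum>i\<in>S. Poly_Mapping.single i 1)"

abbreviation dominating_exps :: "nat \<Rightarrow> (nat \<Rightarrow>\<^sub>0 nat) set" where
  "dominating_exps n \<equiv> set_exp ` {S. minimal_dominating_set (cycle_graph n) S}"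

lemma prod_mvar: "(\<Prod>i\<in>S. mvar i) = Poly_Mapping.single (set_exp S) (1 :: 'k::field)"
proof (induction S rule: infinite_finite_induct)
  case (insert i S)
  then show ?case by (simp add: set_exp_def mvar_def mult_single)
qed (simp_all add: set_exp_def)

lemma lookup_set_exp: "finite S \<Longrightarrow> Poly_Mapping.lookup (set_exp S) v = (if v \<in> S then 1 else 0)"
  by (simp add: set_exp_def lookup_sum lookup_single when_def)

text \<open>The centre is written as a successor modulo \<open>n\<close> so that the neighbourhood is the window that
  starts at \<open>j\<close>.\<close>

lemma closed_nbhd_cycle:
  assumes "n \<ge> 3"
  shows "closed_nbhd (cycle_graph n) (Suc (Suc j mod n))
    = {Suc (j mod n), Suc (Suc j mod n), Suc (Suc (Suc j) mod n)}"
proof -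
  define a where "a = j mod n"
  have a: "a < n" using assms by (simp add: a_def)
  have 1: "Suc j mod n = (if Suc a = n then 0 else Suc a)"
    by (simp add: a_def mod_Suc)
  have 2: "Suc (Suc j) mod n = (if Suc a = n then 1 else if Suc (Suc a) = n then 0 else Suc (Suc a))"
    using assms 1 by (subst mod_Suc) auto
  have nbhd: "closed_nbhd (cycle_graph n) v
      = {u. u = v \<or> (u \<in> {1..n} \<and> v = (if u = n then 1 else u + 1)) \<or> (v \<in> {1..n} \<and> u = (if v = n then 1 else v + 1))}" for v
    by (auto simp: closed_nbhd_def cycle_graph_def image_iff doubleton_eq_iff)
  show ?thesis
    unfolding nbhd 1 2 a_def[symmetric] using a assms by (auto split: if_splits)
qed

lemma dominating_set_cycle:
  assumes "n \<ge> 3"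
  shows "dominating_set (cycle_graph n) S \<longleftrightarrow> S \<subseteq> {1..n} \<and>
    (\<forall>j. Suc (j mod n) \<in> S \<or> Suc (Suc j mod n) \<in> S \<or> Suc (Suc (Suc j) mod n) \<in> S)"
proof -
  have verts: "verts (cycle_graph n) = {1..n}" by (simp add: cycle_graph_def)
  have "(\<forall>v\<in>{1..n}. S \<inter> closed_nbhd (cycle_graph n) v \<noteq> {})
      \<longleftrightarrow> (\<forall>j. S \<inter> closed_nbhd (cycle_graph n) (Suc (Suc j mod n)) \<noteq> {})" (is "?L \<longleftrightarrow> ?R")
  proof
    assume ?L
    then show ?R using assms by (auto simp: Suc_le_eq)
  next
    assume ?R
    show ?L
    proof
      fix v assume v: "v \<in> {1..n}"
      then have "Suc (v + n - 2) mod n = v - 1"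
        using assms by (cases v) auto
      then show "S \<inter> closed_nbhd (cycle_graph n) v \<noteq> {}"
        using \<open>?R\<close>[rule_format, of "v + n - 2"] v by simp
    qed
  qed
  then show ?thesis
    unfolding dominating_set_def verts closed_nbhd_cycle[OF assms] by auto
qed

lemma minimal_dominating_subset:
  assumes "dominating_set (cycle_graph n) S"
  obtains T where "T \<subseteq> S" "minimal_dominating_set (cycle_graph n) T"
proof -
  have "finite {T. T \<subseteq> S \<and> dominating_set (cycle_graph n) T}"
    using assms by (auto simp: dominating_set_def cycle_graph_def intro: finite_subset)
  then obtain T where "T \<subseteq> S" "dominating_set (cycle_graph n) T"
    "\<forall>U\<in>{T. T \<subseteq> S \<and> dominating_set (cycle_graph n) T}. U \<subseteq> T \<longrightarrow> T = U"
    using finite_has_minimal2[of "{T. T \<subseteq> S \<and> dominating_set (cycle_graph n) T}" S] assms by auto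
  then show thesis
    by (intro that[of T]) (auto simp: minimal_dominating_set_def)
qed

lemma minimal_dominating_cycle:
  assumes "minimal_dominating_set (cycle_graph n) S"
  shows "finite S" "S \<subseteq> {1..n}"
  using assms by (auto simp: minimal_dominating_set_def dominating_set_def cycle_graph_def intro: finite_subset)

lemma staircase_of_power_exps:
  assumes "n \<ge> 3" "e \<in> power_exps {1..n} (dominating_exps n) k"
  shows "staircase n 3 (int k) (partial_sums n e n) (partial_sums n e)"
  using assms(2)
proof (induction k arbitrary: e)
  case 0
  show ?case by (simp add: staircase_partial_sums)
next
  case (Suc k)
  obtain f g where fg: "f \<in> dominating_exps n" "g \<in> power_exps {1..n} (dominating_exps n) k" "e = f + g"
    using Suc.prems by (rule power_exps_SucE)
  then obtain S where S: "minimal_dominating_set (cycle_graph n) S" "f = set_exp S" by auto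
  have "partial_sums n f j + 1 \<le> partial_sums n f (j + 3)" for j
    using S dominating_set_cycle[OF assms(1), of S] minimal_dominating_cycle(1)[OF S(1)]
    by (auto simp: minimal_dominating_set_def numeral_3_eq_3 partial_sums_Suc lookup_set_exp)
  then have "staircase n 3 1 (partial_sums n f n) (partial_sums n f)"
    using staircase_partial_sums[of n 3 f] by (simp add: staircase_def)
  from staircase_combination[OF this Suc.IH[OF fg(2)], of 1 1] show ?case
    by (simp add: fg(3) partial_sums_add)
qed

text \<open>The support of the vector meets every window, so it is a dominating set; the vector is a
  minimal dominating set inside the support plus a remainder.\<close>

lemma steps_in_exps_one:
  assumes "n \<ge> 3" "staircase n 3 1 m Y"
  shows "steps n Y \<in> power_exps {1..n} (dominating_exps n) 1"
proof -
  let ?S = "Poly_Mapping.keys (steps n Y)"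
  have step: "Y (Suc t) - Y t = int (Poly_Mapping.lookup (steps n Y) (Suc (t mod n)))" for t
    using staircase_step[OF assms(2), of t] assms by (simp add: lookup_steps staircase_def)
  have "Suc (j mod n) \<in> ?S \<or> Suc (Suc j mod n) \<in> ?S \<or> Suc (Suc (Suc j) mod n) \<in> ?S" for j
  proof -
    have "Y j + 1 \<le> Y (Suc (Suc (Suc j)))"
      using assms(2) by (simp add: staircase_def numeral_3_eq_3)
    with step[of j] step[of "Suc j"] step[of "Suc (Suc j)"] show ?thesis
      by (auto simp: in_keys_iff)
  qed
  then have "dominating_set (cycle_graph n) ?S"
    using assms(1) keys_steps by (simp add: dominating_set_cycle)
  then obtain T where T: "T \<subseteq> ?S" "minimal_dominating_set (cycle_graph n) T"
    by (rule minimal_dominating_subset)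
  have "finite T"
    using T(2) by (rule minimal_dominating_cycle)
  have "Poly_Mapping.lookup (set_exp T) v \<le> Poly_Mapping.lookup (steps n Y) v" for v
    using T(1) by (auto simp: lookup_set_exp[OF \<open>finite T\<close>] in_keys_iff subset_iff Suc_le_eq)
  then have "steps n Y = (steps n Y - set_exp T) + set_exp T"
    by (intro poly_mapping_eqI) (simp add: lookup_add lookup_minus)
  moreover have "Poly_Mapping.keys (steps n Y - set_exp T) \<subseteq> {1..n}"
    using keys_steps[of n Y] by (auto simp: in_keys_iff lookup_minus subset_iff)
  moreover have "set_exp T \<in> power_exps {1..n} (dominating_exps n) 1"
    using T(2) by (intro generator_in_power_exps) auto
  ultimately show ?thesis
    using power_exps_times_monomial by metis
qed

text \<open>If the total sum is a multiple \<open>p q\<close> of \<open>p\<close>, dominating vectors of sum \<open>q\<close> can be removed one by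
  one: split \<open>Y\<close> as \<open>Y / (p + 1)\<close> plus \<open>p Y / (p + 1)\<close>, whose total sums are integers, and round.\<close>

lemma steps_in_power_exps:
  assumes "n \<ge> 3" "staircase n 3 (int p) (int p * q) Y"
  shows "steps n Y \<in> power_exps {1..n} (dominating_exps n) p"
  using assms(2)
proof (induction p arbitrary: Y)
  case 0
  show ?case
    using keys_steps[of n Y] by (auto simp: power_exps_def)
next
  case (Suc p)
  define D where "D = int (Suc p)"
  have D: "D > 0" by (simp add: D_def)
  have U: "staircase n 3 (D * 1) (D * q) Y"
    using Suc.prems by (simp add: D_def)
  have "staircase n 3 (D * int p) (D * (int p * q)) (\<lambda>j. int p * Y j)"
    using staircase_combination[OF Suc.prems Suc.prems, of "int p" 0] by (simp add: D_def algebra_simps)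
  then obtain B C where BC: "\<And>j. Y j = B j + C j" "staircase n 3 1 q B"
      "staircase n 3 (int p) (int p * q) C"
    using staircase_split[OF D U, of "int p" "int p * q" "\<lambda>j. int p * Y j" Y]
    by (auto simp: D_def algebra_simps)
  have "Y = (\<lambda>j. B j + C j)"
    using BC(1) by blast
  then have "steps n Y = steps n B + steps n C"
    using steps_add[OF BC(2,3)] by simp
  moreover have "steps n B \<in> power_exps {1..n} (dominating_exps n) 1"
    using assms(1) BC(2) by (rule steps_in_exps_one)
  moreover note Suc.IH[OF BC(3)]
  ultimately show ?case
    using power_exps_add[of "steps n B" _ _ 1 "steps n C" p] by simp
qed

text \<open>Let \<open>e\<close> have total sum \<open>k q + r\<close> with \<open>0 \<le> r < k\<close>. For \<open>r = 0\<close> the partial sums of \<open>e\<close> themselves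
  form a staircase with \<open>p = k\<close> in \<open>steps_in_power_exps\<close>.

  Otherwise \<open>e\<close> has to become a sum of \<open>p = k - r\<close> dominating vectors of sum \<open>q\<close> and \<open>r\<close> of sum
  \<open>q + 1\<close>. Among the \<open>k N\<close> dominating sets that represent \<open>N e\<close>, let the \<open>P\<close> sets of size at most
  \<open>q\<close> have partial sums \<open>X\<^sub>1\<close>, and let the \<open>R\<close> larger ones, together with the remainder, have
  partial sums \<open>X\<^sub>2\<close>. In total, the first sum falls short of average size \<open>q\<close> by \<open>d\<^sub>1 = P q - X\<^sub>1 n\<close> and the second
  exceeds it by \<open>d\<^sub>2 = X\<^sub>2 n - R q\<close>. A mixture \<open>\<alpha> X\<^sub>1 + \<beta> X\<^sub>2\<close> has average size \<open>q\<close> exactly if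
  \<open>\<alpha> d\<^sub>1 = \<beta> d\<^sub>2\<close>. Scaling it to total weight \<open>p\<close> gives \<open>U / D\<close> with
  \<open>U = p (d\<^sub>2 X\<^sub>1 + d\<^sub>1 X\<^sub>2)\<close> and \<open>D = P d\<^sub>2 + R d\<^sub>1\<close>. What remains of \<open>e\<close> is \<open>V / D\<close> with
  \<open>V = r ((d\<^sub>2 - R) X\<^sub>1 + (P + d\<^sub>1) X\<^sub>2)\<close>, a mixture of weight \<open>r\<close> and average size \<open>q + 1\<close>, whose
  coefficients are nonnegative since \<open>d\<^sub>2 \<ge> R\<close>.\<close>

lemma cycle_decomposition:
  assumes n: "n \<ge> 3" and N: "N \<ge> 1"
    and Ne: "nsmul N e \<in> power_exps {1..n} (dominating_exps n) (k * N)"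
  shows "e \<in> power_exps {1..n} (dominating_exps n) k"
proof -
  let ?E = "power_exps {1..n} (dominating_exps n)"
  obtain b M where bM: "nsmul N e = b + sum_mset M" "Poly_Mapping.keys b \<subseteq> {1..n}"
    "set_mset M \<subseteq> dominating_exps n" "size M = k * N"
    using Ne by (auto simp: power_exps_def)
  have gens: "Poly_Mapping.keys f \<subseteq> {1..n}" if "f \<in># M" for f
    using that bM(3) minimal_dominating_cycle by (fastforce simp: in_keys_iff lookup_set_exp split: if_splits)
  have "Poly_Mapping.keys (sum_mset M) \<subseteq> {1..n}"
    using gens by (induction M) (auto simp: keys_add_nat)
  then have "Poly_Mapping.keys (nsmul N e) \<subseteq> {1..n}"
    using bM(1,2) by (simp add: keys_add_nat)
  then have keys: "Poly_Mapping.keys e \<subseteq> {1..n}"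
    using N by (auto simp: in_keys_iff lookup_nsmul subset_iff)
  show ?thesis
  proof (cases "k = 0")
    case True
    with keys show ?thesis by (auto simp: power_exps_def)
  next
    case False
    define A where "A = partial_sums n e"
    define t where "t = nat (A n)"
    define q r p where "q = int (t div k)" and "r = t mod k" and "p = k - r"
    have rk: "r < k" and pk: "int p = int k - int r"
      using False by (auto simp: r_def p_def)
    have An: "A n = int k * q + int r"
      using partial_sums_nonneg[of n e n] mult_div_mod_eq[of k t]
      by (simp add: A_def t_def q_def r_def flip: of_nat_mult of_nat_add)
    have NA: "partial_sums n (nsmul N e) j = int N * A j" for j
      by (simp add: partial_sums_nsmul A_def)
    show ?thesis
    proof (cases "r = 0")
      case True
      have "staircase n 3 (int N * int k) (int N * (int k * q)) (\<lambda>j. int N * A j)"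
        using staircase_of_power_exps[OF n Ne] True NA[abs_def] by (simp add: An mult.commute)
      then have "staircase n 3 (int k) (int k * q) A"
        using staircase_div[of n 3 "int N" "int k" "int k * q" "\<lambda>j. int N * A j" 0] N by simp
      then show ?thesis
        using steps_in_power_exps[OF n, of k q A] steps_partial_sums[OF keys] by (simp add: A_def)
    next
      case False
      define M1 M2 where "M1 = filter_mset (\<lambda>f. partial_sums n f n \<le> q) M"
        and "M2 = filter_mset (\<lambda>f. \<not> partial_sums n f n \<le> q) M"
      have M: "M = M1 + M2"
        by (simp add: M1_def M2_def)
      define X1 X2 where "X1 = partial_sums n (sum_mset M1)" and "X2 = partial_sums n (b + sum_mset M2)"
      define P R where "P = int (size M1)" and "R = int (size M2)"
      have st1: "staircase n 3 P (X1 n) X1"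
        unfolding X1_def P_def
        using bM(3) M by (intro staircase_of_power_exps[OF n])
          (auto simp: power_exps_def intro!: exI[of _ 0] exI[of _ M1])
      have st2: "staircase n 3 R (X2 n) X2"
        unfolding X2_def R_def
        using bM(2,3) M by (intro staircase_of_power_exps[OF n]) (auto simp: power_exps_def)
      have X: "X1 j + X2 j = int N * A j" for j
        unfolding NA[symmetric] X1_def X2_def bM(1) M by (simp add: partial_sums_add)
      have PR: "P + R = int k * int N"
        using bM(4) M by (simp add: P_def R_def flip: of_nat_add of_nat_mult)
      have "X1 n \<le> P * q"
        unfolding X1_def P_def by (rule partial_sums_sum_mset_le) (simp add: M1_def)
      moreover define d1 where "d1 = P * q - X1 n"
      ultimately have d1: "d1 \<ge> 0" by simp
      have "R * (q + 1) \<le> partial_sums n (sum_mset M2) n"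
        unfolding R_def by (rule partial_sums_sum_mset_ge) (simp add: M2_def)
      then have "R * (q + 1) \<le> X2 n"
        using partial_sums_nonneg[of n b n] by (simp add: X2_def partial_sums_add)
      moreover define d2 where "d2 = X2 n - R * q"
      ultimately have d2: "d2 \<ge> R" by (simp add: algebra_simps)
      have d12: "d2 - d1 = int N * int r"
      proof -
        have "d2 - d1 = (X1 n + X2 n) - (P + R) * q"
          by (simp add: d1_def d2_def algebra_simps)
        also have "\<dots> = int N * int r"
          unfolding X PR An by (simp add: algebra_simps)
        finally show ?thesis .
      qed
      \<comment> \<open>If all sets had size greater than \<open>q\<close>, the average would be at least \<open>q + 1\<close>.\<close>
      have "P > 0"
      proof (rule ccontr)
        assume "\<not> P > 0"
        then have P: "P = 0" "M1 = {#}" by (auto simp: P_def)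
        then have "d1 = 0" by (simp add: d1_def X1_def partial_sums_zero)
        then have "int N * int r \<ge> int k * int N"
          using d12 d2 PR P by simp
        with rk N show False
          by (simp add: mult.commute flip: of_nat_mult)
      qed
      moreover have "d2 > 0"
        using d12 d1 False N by (smt (verit) of_nat_0_less_iff mult_pos_pos neq0_conv not_one_le_zero)
      moreover have "R \<ge> 0" by (simp add: R_def)
      moreover define D where "D = P * d2 + R * d1"
      ultimately have D: "D > 0"
        using d1 by (simp add: add_pos_nonneg)
      define U V where "U j = (int p * d2) * X1 j + (int p * d1) * X2 j"
        and "V j = (int r * (d2 - R)) * X1 j + (int r * (P + d1)) * X2 j" for j
      have X1n: "X1 n = P * q - d1" and X2n: "X2 n = R * q + d2"
        by (simp_all add: d1_def d2_def)
      have stU: "staircase n 3 (D * int p) (D * (int p * q)) U"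
      proof -
        have "(int p * d2) * P + (int p * d1) * R = D * int p"
          "(int p * d2) * X1 n + (int p * d1) * X2 n = D * (int p * q)"
          by (simp_all add: X1n X2n D_def algebra_simps)
        with staircase_combination[OF st1 st2, of "int p * d2" "int p * d1"] \<open>d2 > 0\<close> d1
        show ?thesis by (simp add: U_def[abs_def])
      qed
      have stV: "staircase n 3 (D * int r) (D * (int r * (q + 1))) V"
      proof -
        have "(int r * (d2 - R)) * P + (int r * (P + d1)) * R = D * int r"
          "(int r * (d2 - R)) * X1 n + (int r * (P + d1)) * X2 n = D * (int r * (q + 1))"
          by (simp_all add: X1n X2n D_def algebra_simps)
        with staircase_combination[OF st1 st2, of "int r * (d2 - R)" "int r * (P + d1)"] d2 d1 \<open>P > 0\<close>
        show ?thesis by (simp add: V_def[abs_def])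
      qed
      \<comment> \<open>Multiplied by \<open>N\<close>, the coefficients of \<open>X1\<close> and of \<open>X2\<close> in \<open>U + V\<close> both become \<open>D\<close>.\<close>
      have UV: "U j + V j = D * A j" for j
      proof -
        have "int N * (int p * d2 + int r * (d2 - R)) = (int k * int N) * d2 - (int N * int r) * R"
          by (simp add: pk algebra_simps)
        also have "\<dots> = D"
          unfolding PR[symmetric] d12[symmetric] D_def by (simp add: algebra_simps)
        finally have c1: "int N * (int p * d2 + int r * (d2 - R)) = D" .
        have "int N * (int p * d1 + int r * (P + d1)) = (int k * int N) * d1 + (int N * int r) * P"
          by (simp add: pk algebra_simps)
        also have "\<dots> = D"
          unfolding PR[symmetric] d12[symmetric] D_def by (simp add: algebra_simps)
        finally have c2: "int N * (int p * d1 + int r * (P + d1)) = D" .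
        have "int N * (U j + V j) = (int N * (int p * d2 + int r * (d2 - R))) * X1 j
            + (int N * (int p * d1 + int r * (P + d1))) * X2 j"
          by (simp add: U_def V_def algebra_simps)
        also have "\<dots> = D * (X1 j + X2 j)"
          unfolding c1 c2 by (simp add: algebra_simps)
        also have "\<dots> = int N * (D * A j)"
          unfolding X by simp
        finally show ?thesis using N by simp
      qed
      obtain B C where BC: "\<And>j. A j = B j + C j" "staircase n 3 (int p) (int p * q) B"
          "staircase n 3 (int r) (int r * (q + 1)) C"
        using staircase_split[OF D stU stV UV] by blast
      have "A = (\<lambda>j. B j + C j)"
        using BC(1) by blast
      then have "e = steps n (\<lambda>j. B j + C j)"
        using steps_partial_sums[OF keys] by (simp add: A_def)
      also have "\<dots> = steps n B + steps n C"
        by (rule steps_add[OF BC(2,3)])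
      also have "\<dots> \<in> ?E (p + r)"
        using steps_in_power_exps[OF n BC(2)] steps_in_power_exps[OF n BC(3)] by (rule power_exps_add)
      also have "p + r = k"
        using rk by (simp add: p_def)
      finally show ?thesis .
    qed
  qed
qed

lemma decomposable_generators_cycle:
  assumes "n \<ge> 3"
  shows "decomposable_generators {1..n} (dominating_exps n)"
proof
  show "finite (dominating_exps n)"
    by (intro finite_imageI finite_subset[OF _ finite_Pow_iff[THEN iffD2, OF finite_atLeastAtMost[of 1 n]]])
      (use minimal_dominating_cycle(2) in blast)
  show "Poly_Mapping.keys f \<subseteq> {1..n}" if "f \<in> dominating_exps n" for f
    using that minimal_dominating_cycle by (fastforce simp: in_keys_iff lookup_set_exp split: if_splits)
  have "dominating_set (cycle_graph n) {1..n}"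
    using assms by (auto simp: dominating_set_cycle Suc_le_eq)
  then show "dominating_exps n \<noteq> {}"
    using minimal_dominating_subset by blast
qed (use assms cycle_decomposition in auto)

theorem corollary5p5:
  fixes n :: nat
  assumes "n \<ge> 3"
  shows "normal_ideal (mpoly_ring {1..n})
           (dominating_ideal (cycle_graph n) :: (nat, 'k::field) mpoly set)
       \<and> strong_persistence_property (mpoly_ring {1..n})
           (dominating_ideal (cycle_graph n) :: (nat, 'k::field) mpoly set)
       \<and> persistence_property (mpoly_ring {1..n})
           (dominating_ideal (cycle_graph n) :: (nat, 'k::field) mpoly set)"
proof -
  interpret decomposable_generators "{1..n}" "dominating_exps n"
    using assms by (rule decomposable_generators_cycle)
  have "{\<Prod>i\<in>S. mvar i | S. minimal_dominating_set (cycle_graph n) S}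
      = ((\<lambda>f. Poly_Mapping.single f 1) ` dominating_exps n :: (nat, 'k) mpoly set)"
    by (auto simp: prod_mvar)
  then have "dominating_ideal (cycle_graph n) = (gen_ideal :: (nat, 'k) mpoly set)"
    by (simp add: dominating_ideal_def cycle_graph_def)
  then show ?thesis
    using normal_gen_ideal strong_persistence_gen_ideal persistence_gen_ideal by simp
qed

end
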